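(* Suppose that $0<p<1$ and $f\in L^p(\mathbb{R})$. Then there exist a positive constant $A_p$ (depending only on $p$) and two sequences of rational functions $\{P_k(z)\}_{k\ge1}$ and $\{Q_k(z)\}_{k\ge 1}$ such that $P_k\in H^p(\mathbb{C}_{+1})$, $Q_k\in H^p(\mathbb{C}_{-1})$ for all $k$, and $$\sum_{k=1}^{\infty}\left(\|P_k\|^p_{H^p_{+1}}+\|Q_k\|^p_{H^p_{-1}}\right)\le A_p\|f\|_p^p,\qquad \lim_{n\to\infty}\Big\|f-\sum_{k=1}^{n}(P_k+Q_k)\Big\|_p=0.$$ Moreover, $$g(z)=\sum_{k=1}^{\infty}P_k(z)\in H^p(\mathbb{C}_{+1}),\qquad h(z)=\sum_{k=1}^{\infty}Q_k(z)\in H^p(\mathbb{C}_{-1}),$$ and, denoting by $g(x)$ and $h(x)$ ($x\in\mathbb{R}$) the non-tangential boundary values of $g\in H^p(\mathbb{C}_{+1})$ and $h\in H^p(\mathbb{C}_{-1})$ respectively, one has $f(x)=g(x)+h(x)$ for almost every $x\in\mathbb{R}$ and $$\|f\|_p^p\le\|g\|_p^p+\|h\|_p^p\le A_p\|f\|_p^p.$$ That is, in the sense of $L^p(\mathbb{R})$, $L^p(\mathbb{R})=H^p_{+1}(\mathbb{R})+H^p_{-1}(\mathbb{R})$.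
   Context: For $k=\pm1$, $\mathbb{C}_k=\{z=x+iy: ky>0\}$. For $0<p<\infty$, $H^p(\mathbb{C}_k)$ is the space of functions $f$ analytic in $\mathbb{C}_k$ with $\|f\|_{H^p_k}=\sup_{ky>0}\left(\int_{-\infty}^{\infty}|f(x+iy)|^p\,dx\right)^{1/p}<\infty$. Every $f\in H^p(\mathbb{C}_k)$ has non-tangential boundary limits $f(x)$ at almost every $x\in\mathbb{R}$, and the boundary function belongs to $L^p(\mathbb{R})$; $H^p_k(\mathbb{R})$ denotes the set of functions on $\mathbb{R}$ that are the non-tangential boundary limit of some function in $H^p(\mathbb{C}_k)$. For $0<p<\infty$, $\|f\|_p=\left(\int_{-\infty}^\infty|f(x)|^p\,dx\right)^{1/p}$. *)

theory Defs
  imports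
    "HOL-Complex_Analysis.Complex_Analysis"
    "HOL-Computational_Algebra.Polynomial"
begin

(* Intended for a > 0, so that \<infinity> is sent to \<infinity>. *)
definition epowr :: "ennreal \<Rightarrow> real \<Rightarrow> ennreal" where
  "epowr x a = (if x = \<infinity> then \<infinity> else ennreal (enn2real x powr a))"

(* The value is \<infinity> when |f|^p is not integrable; for p < 1 this is only a quasi-norm. *)
definition Lp_norm :: "real \<Rightarrow> (real \<Rightarrow> complex) \<Rightarrow> ennreal" where
  "Lp_norm p f = epowr (\<integral>\<^sup>+ x. ennreal (norm (f x) powr p) \<partial>lebesgue) (1 / p)"

definition Lp :: "real \<Rightarrow> (real \<Rightarrow> complex) set" where
  "Lp p = {f \<in> borel_measurable lebesgue. Lp_norm p f < \<infinity>}"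

(* Used with k = 1 (upper half-plane) and k = -1 (lower half-plane). *)
definition half_plane :: "real \<Rightarrow> complex set" where
  "half_plane k = {z. k * Im z > 0}"

definition Hp_norm :: "real \<Rightarrow> real \<Rightarrow> (complex \<Rightarrow> complex) \<Rightarrow> ennreal" where
  "Hp_norm p k F = (SUP y \<in> {y. k * y > 0}. Lp_norm p (\<lambda>x. F (Complex x y)))"

(* Elements are total functions whose values outside the half-plane are irrelevant. *)
definition Hp :: "real \<Rightarrow> real \<Rightarrow> (complex \<Rightarrow> complex) set" where
  "Hp p k = {F. F holomorphic_on half_plane k \<and> Hp_norm p k F < \<infinity>}"

definition stolz_cone :: "real \<Rightarrow> real \<Rightarrow> real \<Rightarrow> complex set" where
  "stolz_cone k \<alpha> x = {z \<in> half_plane k. \<bar>Re z - x\<bar> < \<alpha> * \<bar>Im z\<bar>}"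

definition has_nontangential_limit ::
    "real \<Rightarrow> (complex \<Rightarrow> complex) \<Rightarrow> real \<Rightarrow> complex \<Rightarrow> bool" where
  "has_nontangential_limit k F x l \<longleftrightarrow>
     (\<forall>\<alpha>>0. (F \<longlongrightarrow> l) (at (complex_of_real x) within stolz_cone k \<alpha> x))"

definition has_boundary_function ::
    "real \<Rightarrow> (complex \<Rightarrow> complex) \<Rightarrow> (real \<Rightarrow> complex) \<Rightarrow> bool" where
  "has_boundary_function k F u \<longleftrightarrow>
     (AE x in lebesgue. has_nontangential_limit k F x (u x))"

definition Hp_boundary :: "real \<Rightarrow> real \<Rightarrow> (real \<Rightarrow> complex) set" where
  "Hp_boundary p k = {u. \<exists>F \<in> Hp p k. has_boundary_function k F u}"

(* In lowest terms, removable singularities are filled in; at the genuine poles the value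
   is 0 by the division convention. *)
definition rational_function :: "(complex \<Rightarrow> complex) \<Rightarrow> bool" where
  "rational_function R \<longleftrightarrow>
     (\<exists>a b :: complex poly. b \<noteq> 0 \<and> coprime a b \<and> R = (\<lambda>z. poly a z / poly b z))"

end

theory Submission
  imports
    Defs
    "HOL-Computational_Algebra.Field_as_Ring"
    "HOL-Computational_Algebra.Polynomial_Factorial"
begin

text \<open>
  The argument is Aleksandrov's. If \<open>\<bar>w\<bar> = 1\<close> and \<open>w \<noteq> 1\<close>, then
  \<open>1 = - w / (1 - w) - w\<^sup>-\<^sup>1 / (1 - w\<^sup>-\<^sup>1)\<close>. Let \<open>u = (x - \<i>) / (x + \<i>)\<close> and let \<open>R\<close> be a
  trigonometric polynomial in \<open>u\<close>. Multiplied by \<open>R\<close>, with \<open>w = c * u ^ N\<close> and \<open>\<bar>c\<bar> = 1\<close>, the identity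
  splits \<open>R\<close> into two rational functions. For \<open>N\<close> larger than the degree of \<open>R\<close>, the zero of \<open>w\<close> at
  \<open>\<i>\<close> absorbs the pole of \<open>R\<close> there, so the first part is holomorphic in the upper half-plane and,
  symmetrically, the second one is holomorphic in the lower half-plane. The price is a set of simple
  poles on the real line, and these are harmless exactly because \<open>p < 1\<close>: the mean of
  \<open>\<bar>1 - c * v\<bar>\<^sup>-\<^sup>p\<close> over \<open>c\<close> is bounded uniformly in the unimodular number \<open>v\<close>, so a suitable
  rotation \<open>c\<close> makes the integral of \<open>\<bar>R\<bar>\<^sup>p * \<bar>1 - c * u ^ N\<bar>\<^sup>-\<^sup>p\<close> at most a constant times that of
  \<open>\<bar>R\<bar>\<^sup>p\<close> (\<open>exists_good_rotation\<close>).

  Membership in \<open>H\<^sup>p\<close> and boundary values need control inside the half-plane. The key estimate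
  \<open>hardy_part_cone_bound\<close> shows that in every Stolz cone with vertex \<open>x\<close> the holomorphic part is
  at most a constant, depending on the aperture but not on \<open>R\<close>, times its boundary size at \<open>x\<close>, up
  to an error of order \<open>1 / N\<close>. So one function \<open>\<Psi>\<close> on the line, with integral of \<open>\<Psi>\<^sup>p\<close> controlled,
  dominates all nontangential maximal functions at once. From such majorants alone follow the
  \<open>H\<^sup>p\<close> bounds, the locally uniform convergence of the series and, by dominated convergence of
  series, their nontangential limits (\<open>cone_dominated_series\<close>).

  The functions \<open>R\<close> with a factor \<open>(1 - u) ^ s\<close>, which forces decay at infinity, are dense in
  \<open>L\<^sup>p\<close> (\<open>cayley_trig_dense\<close>). Approximating \<open>f\<close> up to half of \<open>\<parallel>f\<parallel>\<^sub>p\<^sup>p\<close>, splitting the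
  approximant and repeating with the remainder yields the two sequences, with geometrically
  decreasing majorants. Conversely, a boundary function of an \<open>H\<^sup>p\<close> function is in \<open>L\<^sup>p\<close> by
  Fatou's lemma.
\<close>

section \<open>The p-th power mass of a function\<close>

text \<open>For \<open>p < 1\<close> the \<open>p\<close>-th power of the quasi-norm is the subadditive quantity, so all
  estimates are made for it.\<close>
definition mass :: "real \<Rightarrow> (real \<Rightarrow> complex) \<Rightarrow> ennreal" where
  "mass p f = (\<integral>\<^sup>+ x. ennreal (norm (f x) powr p) \<partial>lebesgue)"

lemma epowr_epowr_inverse:
  assumes "p > 0"
  shows "epowr (epowr x (1 / p)) p = x"
proof (cases "x = \<infinity>")
  case True
  then show ?thesis by (simp add: epowr_def)
next
  case False
  have "(enn2real x powr (1/p)) powr p = enn2real x powr (1 / p * p)"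
    by (rule powr_powr)
  also have "\<dots> = enn2real x" using assms by (simp add: enn2real_nonneg)
  finally have "(enn2real x powr (1/p)) powr p = enn2real x" .
  with False show ?thesis
    by (simp add: epowr_def ennreal_enn2real_if)
qed

lemma epowr_Lp_norm: "p > 0 \<Longrightarrow> epowr (Lp_norm p f) p = mass p f"
  by (simp add: Lp_norm_def mass_def epowr_epowr_inverse)

lemma epowr_mono:
  assumes "x \<le> y" "a > 0"
  shows "epowr x a \<le> epowr y a"
proof (cases "y = \<infinity>")
  case False
  then have "x \<noteq> \<infinity>" using assms by (auto simp: top_unique)
  with False assms show ?thesis
    by (auto simp: epowr_def intro!: ennreal_leI powr_mono2 enn2real_mono simp: less_top)
qed (simp add: epowr_def)

lemma epowr_less_top_iff: "epowr x a < top \<longleftrightarrow> x < top"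
  by (auto simp: epowr_def less_top)

lemma mem_Lp_iff: "f \<in> Lp p \<longleftrightarrow> f \<in> borel_measurable lebesgue \<and> mass p f < \<infinity>"
  by (simp add: Lp_def Lp_norm_def epowr_less_top_iff mass_def)

lemma Hp_norm_le:
  assumes "p > 0" and "\<And>y. k * y > 0 \<Longrightarrow> mass p (\<lambda>x. F (Complex x y)) \<le> B"
  shows "Hp_norm p k F \<le> epowr B (1 / p)"
  unfolding Hp_norm_def Lp_norm_def
  using assms by (intro SUP_least epowr_mono) (auto simp: mass_def)

lemma mass_horizontal_le:
  assumes "p > 0" and "k * y > 0"
  shows "mass p (\<lambda>x. F (Complex x y)) \<le> epowr (Hp_norm p k F) p"
proof -
  have "Lp_norm p (\<lambda>x. F (Complex x y)) \<le> Hp_norm p k F"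
    unfolding Hp_norm_def using assms by (intro SUP_upper) auto
  with epowr_mono[OF this] epowr_Lp_norm assms show ?thesis by metis
qed

lemma powr_add_le:
  fixes a b :: real
  assumes "0 \<le> a" "0 \<le> b" "0 < p" "p \<le> 1"
  shows "(a + b) powr p \<le> a powr p + b powr p"
proof (cases "a + b = 0")
  case True
  then show ?thesis using assms by simp
next
  case False
  define s where "s = a + b"
  have s: "s > 0" using False assms by (simp add: s_def)
  have less: "t \<le> t powr p" if "0 \<le> t" "t \<le> 1" for t :: real
    using powr_mono'[of p 1 t] that assms by auto
  have "1 = a / s + b / s" using s by (simp add: s_def flip: add_divide_distrib)
  also have "\<dots> \<le> (a / s) powr p + (b / s) powr p"
    using assms s by (intro add_mono less) (auto simp: s_def)
  also have "\<dots> = (a powr p + b powr p) / s powr p"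
    using assms s by (simp add: powr_divide add_divide_distrib)
  finally show ?thesis using s by (simp add: s_def field_simps)
qed

lemma norm_add_powr_le:
  fixes a b :: complex
  assumes "0 < p" "p \<le> 1"
  shows "norm (a + b) powr p \<le> norm a powr p + norm b powr p"
  using powr_mono2[of p "norm (a + b)" "norm a + norm b"] powr_add_le[of "norm a" "norm b" p]
    assms norm_triangle_ineq[of a b] by auto

lemma norm_sum_powr_le:
  fixes a :: "nat \<Rightarrow> complex"
  assumes "0 < p" "p \<le> 1"
  shows "norm (\<Sum>j<n. a j) powr p \<le> (\<Sum>j<n. norm (a j) powr p)"
proof (induction n)
  case (Suc n)
  have "norm (\<Sum>j<Suc n. a j) powr p \<le> norm (\<Sum>j<n. a j) powr p + norm (a n) powr p"
    using norm_add_powr_le[OF assms] by simp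
  with Suc show ?case by simp
qed simp

text \<open>The countable form of subadditivity of \<open>t \<mapsto> t\<^sup>p\<close>; it is what makes series in \<open>L\<^sup>p\<close> and
  \<open>H\<^sup>p\<close> with summable masses behave as in a Banach space although \<open>p < 1\<close>.\<close>
lemma norm_sums_powr_le:
  fixes a :: "nat \<Rightarrow> complex"
  assumes "0 < p" "p \<le> 1" and "a sums b"
  shows "ennreal (norm b powr p) \<le> (\<Sum>j. ennreal (norm (a j) powr p))"
proof (rule LIMSEQ_le_const2)
  show "(\<lambda>n. ennreal (norm (\<Sum>j<n. a j) powr p)) \<longlonglongrightarrow> ennreal (norm b powr p)"
    using assms by (auto simp: sums_def intro!: tendsto_intros)
  have "ennreal (norm (\<Sum>j<n. a j) powr p) \<le> (\<Sum>j. ennreal (norm (a j) powr p))" for n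
  proof -
    have "ennreal (norm (\<Sum>j<n. a j) powr p) \<le> (\<Sum>j<n. ennreal (norm (a j) powr p))"
      using norm_sum_powr_le[OF assms(1,2)] by (simp add: sum_ennreal ennreal_leI)
    also have "\<dots> \<le> (\<Sum>j. ennreal (norm (a j) powr p))"
      by (intro sum_le_suminf) auto
    finally show ?thesis .
  qed
  then show "\<exists>N. \<forall>n\<ge>N. ennreal (norm (\<Sum>j<n. a j) powr p) \<le> (\<Sum>j. ennreal (norm (a j) powr p))"
    by blast
qed

text \<open>Eventually \<open>a j \<le> (a j)\<^sup>p\<close>, because \<open>a j\<close> tends to 0 and \<open>p \<le> 1\<close>.\<close>
lemma summable_of_summable_powr:
  fixes a :: "nat \<Rightarrow> real"
  assumes "0 < p" "p \<le> 1" and nn: "\<And>j. 0 \<le> a j" and s: "summable (\<lambda>j. a j powr p)"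
  shows "summable a"
proof (rule summable_comparison_test_ev[OF _ s])
  have "(\<lambda>j. a j powr p) \<longlonglongrightarrow> 0" by (rule summable_LIMSEQ_zero[OF s])
  then have "\<forall>\<^sub>F j in sequentially. a j powr p < 1" by (rule order_tendstoD) simp
  then show "\<forall>\<^sub>F j in sequentially. norm (a j) \<le> a j powr p"
  proof eventually_elim
    case (elim j)
    then have "a j < 1"
      using nn[of j] assms(1) ge_one_powr_ge_zero[of "a j" p] by linarith
    then show ?case using powr_mono'[of p 1 "a j"] nn[of j] assms by auto
  qed
qed

lemma mass_add_le:
  assumes "0 < p" "p \<le> 1"
    and [measurable]: "f \<in> borel_measurable lebesgue" "g \<in> borel_measurable lebesgue"
  shows "mass p (\<lambda>x. f x + g x) \<le> mass p f + mass p g"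
proof -
  have "mass p (\<lambda>x. f x + g x)
      \<le> (\<integral>\<^sup>+ x. ennreal (norm (f x) powr p) + ennreal (norm (g x) powr p) \<partial>lebesgue)"
    unfolding mass_def using norm_add_powr_le[OF assms(1,2)]
    by (intro nn_integral_mono) (auto simp flip: ennreal_plus intro!: ennreal_leI)
  also have "\<dots> = mass p f + mass p g"
    unfolding mass_def by (intro nn_integral_add) measurable
  finally show ?thesis .
qed

lemma mass_cong_AE: "(AE x in lebesgue. f x = g x) \<Longrightarrow> mass p f = mass p g"
  unfolding mass_def by (rule nn_integral_cong_AE) auto

lemma mass_minus: "mass p (\<lambda>x. - f x) = mass p f"
  by (simp add: mass_def)

lemma mass_lborel: "mass p f = (\<integral>\<^sup>+ x. ennreal (norm (f x) powr p) \<partial>lborel)"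
  by (simp add: mass_def nn_integral_completion)

text \<open>The sum of the \<open>p\<close>-th powers has finite integral, hence is finite almost everywhere, and
  \<open>p \<le> 1\<close> passes to the sum of the first powers.\<close>
lemma AE_summable_of_summable_mass:
  fixes a :: "nat \<Rightarrow> real \<Rightarrow> complex"
  assumes "0 < p" "p \<le> 1" and [measurable]: "\<And>j. a j \<in> borel_measurable lebesgue"
    and fin: "(\<Sum>j. mass p (a j)) < \<infinity>"
  shows "AE x in lebesgue. summable (\<lambda>j. norm (a j x))"
proof -
  have "(\<integral>\<^sup>+ x. (\<Sum>j. ennreal (norm (a j x) powr p)) \<partial>lebesgue) = (\<Sum>j. mass p (a j))"
    unfolding mass_def by (intro nn_integral_suminf) measurable
  with fin have "AE x in lebesgue. (\<Sum>j. ennreal (norm (a j x) powr p)) \<noteq> \<infinity>"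
    by (intro nn_integral_noteq_infinite) auto
  then show ?thesis
  proof eventually_elim
    case (elim x)
    then have "summable (\<lambda>j. norm (a j x) powr p)"
      by (intro summable_suminf_not_top) auto
    then show ?case by (rule summable_of_summable_powr[OF assms(1,2), rotated]) auto
  qed
qed

section \<open>The Cayley coordinate and the cone estimate\<close>

text \<open>The Moebius map taking the half-plane with sign \<open>k\<close> to the unit disc; treating both signs at
  once makes every estimate below serve both half-planes.\<close>
definition cayley :: "real \<Rightarrow> complex \<Rightarrow> complex" where
  "cayley k z = (z - of_real k * \<i>) / (z + of_real k * \<i>)"

lemma norm_add_square:
  assumes "\<bar>k\<bar> = 1"
  shows "(norm (z + of_real k * \<i>))\<^sup>2 = (Re z)\<^sup>2 + (1 + k * Im z)\<^sup>2"
proof -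
  have "k = 1 \<or> k = - 1" using assms by linarith
  then show ?thesis
    unfolding cmod_power2 by (auto simp: power2_eq_square algebra_simps)
qed

lemma norm_diff_square:
  assumes "\<bar>k\<bar> = 1"
  shows "(norm (z - of_real k * \<i>))\<^sup>2 = (norm (z + of_real k * \<i>))\<^sup>2 - 4 * (k * Im z)"
proof -
  have "k = 1 \<or> k = - 1" using assms by linarith
  then show ?thesis
    unfolding cmod_power2 by (auto simp: power2_eq_square algebra_simps)
qed

lemma norm_add_ge:
  assumes "\<bar>k\<bar> = 1" "k * Im z \<ge> 0"
  shows "norm (z + of_real k * \<i>) \<ge> 1 + k * Im z"
proof (rule power2_le_imp_le)
  show "(1 + k * Im z)\<^sup>2 \<le> (norm (z + of_real k * \<i>))\<^sup>2"
    by (simp add: norm_add_square[OF assms(1)])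
qed simp

lemma add_nonzero:
  assumes "\<bar>k\<bar> = 1" "k * Im z \<ge> 0"
  shows "z + of_real k * \<i> \<noteq> 0"
  using norm_add_ge[OF assms] assms(2) by force

lemma one_minus_cayley:
  assumes "z + of_real k * \<i> \<noteq> 0"
  shows "1 - cayley k z = 2 * of_real k * \<i> / (z + of_real k * \<i>)"
  using assms by (simp add: cayley_def field_simps)

lemma norm_one_minus_cayley:
  assumes "\<bar>k\<bar> = 1" "k * Im z \<ge> 0"
  shows "norm (1 - cayley k z) = 2 / norm (z + of_real k * \<i>)"
  using assms by (simp add: one_minus_cayley[OF add_nonzero[OF assms]] norm_divide norm_mult)

lemma cayley_diff:
  assumes "z + of_real k * \<i> \<noteq> 0" "w + of_real k * \<i> \<noteq> 0"
  shows "cayley k z - cayley k w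
       = 2 * of_real k * \<i> * (z - w) / ((z + of_real k * \<i>) * (w + of_real k * \<i>))"
  using assms by (simp add: cayley_def field_simps)

lemma norm_cayley_square:
  assumes "\<bar>k\<bar> = 1" "k * Im z \<ge> 0"
  shows "(norm (cayley k z))\<^sup>2 = 1 - 4 * (k * Im z) / (norm (z + of_real k * \<i>))\<^sup>2"
proof -
  have "(norm (cayley k z))\<^sup>2
      = ((norm (z + of_real k * \<i>))\<^sup>2 - 4 * (k * Im z)) / (norm (z + of_real k * \<i>))\<^sup>2"
    unfolding cayley_def norm_divide power_divide norm_diff_square[OF assms(1)] ..
  then show ?thesis using add_nonzero[OF assms] by (simp add: diff_divide_distrib)
qed

lemma norm_cayley_of_real:
  assumes "\<bar>k\<bar> = 1"
  shows "norm (cayley k (of_real x)) = 1"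
proof -
  have "(norm (cayley k (of_real x)))\<^sup>2 = 1"
    using norm_cayley_square[OF assms, of "of_real x"] by simp
  then show ?thesis using power2_eq_imp_eq[of "norm (cayley k (of_real x))" 1] by simp
qed

lemma one_minus_norm_cayley_ge:
  assumes "\<bar>k\<bar> = 1" "k * Im z \<ge> 0"
  shows "2 * (k * Im z) / (norm (z + of_real k * \<i>))\<^sup>2 \<le> 1 - norm (cayley k z)"
proof -
  have "1 - (norm (cayley k z))\<^sup>2 \<le> 2 * (1 - norm (cayley k z))"
    using zero_le_power2[of "1 - norm (cayley k z)"] by (simp add: power2_eq_square algebra_simps)
  then show ?thesis using norm_cayley_square[OF assms] by simp
qed

lemma norm_cayley_less:
  assumes "\<bar>k\<bar> = 1" "k * Im z > 0"
  shows "norm (cayley k z) < 1"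
proof -
  have "2 * (k * Im z) / (norm (z + of_real k * \<i>))\<^sup>2 > 0"
    using assms add_nonzero[of k z] by simp
  then show ?thesis using one_minus_norm_cayley_ge[of k z] assms by linarith
qed

text \<open>On the real line the two coordinates are inverse to each other, so a trigonometric polynomial
  in one of them is one in the other.\<close>
lemma cayley_uminus:
  "cayley (-1) (of_real x) = inverse (cayley 1 (of_real x))"
  by (simp add: cayley_def)

lemma poly_bounded_Lipschitz_unit_disc:
  fixes E :: "complex poly"
  obtains L where "L > 0" "\<And>a. norm a \<le> 1 \<Longrightarrow> norm (poly E a) \<le> L"
    "\<And>a b. norm a \<le> 1 \<Longrightarrow> norm b \<le> 1 \<Longrightarrow> norm (poly E a - poly E b) \<le> L * norm (a - b)"
proof -
  have "\<exists>L>0. (\<forall>a. norm a \<le> 1 \<longrightarrow> norm (poly E a) \<le> L) \<and>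
      (\<forall>a b. norm a \<le> 1 \<longrightarrow> norm b \<le> 1 \<longrightarrow> norm (poly E a - poly E b) \<le> L * norm (a - b))"
  proof (induction E)
    case 0
    then show ?case by (intro exI[of _ 1]) auto
  next
    case (pCons e E)
    then obtain L where L: "L > 0" "\<And>a. norm a \<le> 1 \<Longrightarrow> norm (poly E a) \<le> L"
      "\<And>a b. norm a \<le> 1 \<Longrightarrow> norm b \<le> 1 \<Longrightarrow> norm (poly E a - poly E b) \<le> L * norm (a - b)"
      by blast
    show ?case
    proof (intro exI[of _ "2 * L + norm e"] conjI allI impI)
      show "2 * L + norm e > 0" using L(1) by (simp add: add_pos_nonneg)
      show "norm (poly (pCons e E) a) \<le> 2 * L + norm e" if "norm a \<le> 1" for a
      proof -
        have "norm (poly (pCons e E) a) \<le> norm e + norm a * norm (poly E a)"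
          using norm_triangle_ineq[of e "a * poly E a"] by (simp add: norm_mult)
        also have "\<dots> \<le> norm e + 1 * L" using that L by (intro add_mono mult_mono) auto
        finally show ?thesis using L(1) by simp
      qed
      show "norm (poly (pCons e E) a - poly (pCons e E) b) \<le> (2 * L + norm e) * norm (a - b)"
        if "norm a \<le> 1" "norm b \<le> 1" for a b
      proof -
        have "poly (pCons e E) a - poly (pCons e E) b
            = a * (poly E a - poly E b) + (a - b) * poly E b" by (simp add: algebra_simps)
        then have "norm (poly (pCons e E) a - poly (pCons e E) b)
            \<le> norm a * norm (poly E a - poly E b) + norm (a - b) * norm (poly E b)"
          by (metis norm_mult norm_triangle_ineq)
        also have "\<dots> \<le> 1 * (L * norm (a - b)) + norm (a - b) * L"
          using that L by (intro add_mono mult_mono) auto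
        also have "\<dots> \<le> (2 * L + norm e) * norm (a - b)" by (simp add: algebra_simps)
        finally show ?thesis .
      qed
    qed
  qed
  with that show thesis by blast
qed

text \<open>Passing from \<open>a, b\<close> to their powers preserves nontangential approach to the circle with the
  same constant. This is what makes the cone estimate uniform in \<open>N\<close>.\<close>
lemma norm_power_diff_le:
  fixes a b :: complex
  assumes "norm b = 1" "norm a < 1" "norm (a - b) \<le> \<kappa> * (1 - norm a)"
  shows "norm (a ^ N - b ^ N) \<le> \<kappa> * (1 - norm a ^ N)"
proof -
  have "norm (a ^ N - b ^ N) = norm (a - b) * norm (\<Sum>i<N. b ^ (N - Suc i) * a ^ i)"
    by (subst power_diff_sumr2) (simp add: norm_mult)
  also have "norm (\<Sum>i<N. b ^ (N - Suc i) * a ^ i) \<le> (\<Sum>i<N. norm a ^ i)"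
    by (rule order_trans[OF norm_sum]) (simp add: norm_mult norm_power assms(1))
  also have "norm (a - b) * (\<Sum>i<N. norm a ^ i) \<le> \<kappa> * (1 - norm a) * (\<Sum>i<N. norm a ^ i)"
    by (intro mult_right_mono assms sum_nonneg) auto
  also have "\<dots> = \<kappa> * (1 - norm a ^ N)"
    using assms(2) by (simp add: one_diff_power_eq)
  finally show ?thesis by (simp add: mult_left_mono)
qed

text \<open>The sum \<open>1 + r + \<dots> + r ^ (N - 1)\<close> has at least \<open>j + 1\<close> terms that are no smaller than
  \<open>r ^ j\<close>. Hence high powers of \<open>r\<close> compensate a factor \<open>1 - r\<close> at the rate \<open>1 / N\<close>.\<close>
lemma power_times_one_minus_le:
  fixes r :: real
  assumes "0 \<le> r" "r \<le> 1" "j < N"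
  shows "real (Suc j) * r ^ j * (1 - r) \<le> 1 - r ^ N"
proof -
  have "real (Suc j) * r ^ j = (\<Sum>i<Suc j. r ^ j)" by simp
  also have "\<dots> \<le> (\<Sum>i<Suc j. r ^ i)"
    using assms by (intro sum_mono power_decreasing) auto
  also have "\<dots> \<le> (\<Sum>i<N. r ^ i)"
    using assms by (intro sum_mono2) auto
  finally have "real (Suc j) * r ^ j * (1 - r) \<le> (\<Sum>i<N. r ^ i) * (1 - r)"
    using assms by (intro mult_right_mono) auto
  then show ?thesis by (simp add: one_diff_power_eq mult.commute)
qed

lemma cone_comparison:
  assumes "\<bar>k\<bar> = 1" "\<alpha> > 0" "z \<in> stolz_cone k \<alpha> x"
  shows "norm (of_real x + of_real k * \<i>) \<le> (2 + \<alpha>) * norm (z + of_real k * \<i>)"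
    and "norm (z - of_real x) \<le> (1 + \<alpha>) * (k * Im z)"
    and "k * Im z > 0"
    and "k * Im z \<le> 1 \<Longrightarrow> norm (z + of_real k * \<i>) \<le> (2 + \<alpha>) * norm (of_real x + of_real k * \<i>)"
proof -
  have Y: "k * Im z > 0" and R: "\<bar>Re z - x\<bar> < \<alpha> * \<bar>Im z\<bar>"
    using assms(3) by (auto simp: stolz_cone_def half_plane_def)
  show "k * Im z > 0" by fact
  have absY: "\<bar>Im z\<bar> = k * Im z" using Y assms(1) by (metis abs_mult abs_of_pos mult_1)
  show d: "norm (z - of_real x) \<le> (1 + \<alpha>) * (k * Im z)"
    using cmod_le[of "z - of_real x"] R absY by (simp add: algebra_simps)
  have a: "norm (of_real x + of_real k * \<i>) \<le> norm (z + of_real k * \<i>) + norm (z - of_real x)"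
    using norm_triangle_ineq4[of "z + of_real k * \<i>" "z - of_real x"]
    by (simp add: add.commute)
  have "(1 + \<alpha>) * (k * Im z) \<le> (1 + \<alpha>) * norm (z + of_real k * \<i>)"
    using norm_add_ge[of k z] Y assms by (intro mult_left_mono) auto
  with a d show "norm (of_real x + of_real k * \<i>) \<le> (2 + \<alpha>) * norm (z + of_real k * \<i>)"
    by (simp add: algebra_simps)
  have b: "norm (z + of_real k * \<i>) \<le> norm (of_real x + of_real k * \<i>) + norm (z - of_real x)"
    using norm_triangle_ineq[of "of_real x + of_real k * \<i>" "z - of_real x"]
    by (simp add: add.commute)
  have c: "norm (of_real x + of_real k * \<i>) \<ge> 1"
    using norm_add_ge[of k "of_real x"] assms by simp
  show "norm (z + of_real k * \<i>) \<le> (2 + \<alpha>) * norm (of_real x + of_real k * \<i>)"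
    if "k * Im z \<le> 1"
  proof -
    have "(1 + \<alpha>) * (k * Im z) \<le> (1 + \<alpha>) * norm (of_real x + of_real k * \<i>)"
      using c that assms(2) by (intro mult_left_mono) auto
    with b d show ?thesis by (simp add: algebra_simps)
  qed
qed

text \<open>The function \<open>- R * w / (1 - w)\<close> for \<open>w = c * u ^ N\<close> and \<open>R = (1 - u) ^ s * E(u) / u ^ n\<close>, where
  \<open>u\<close> is the Cayley coordinate, written so that for \<open>n \<le> N\<close> no pole is left where \<open>u = 0\<close>.\<close>
definition hardy_part :: "real \<Rightarrow> nat \<Rightarrow> complex poly \<Rightarrow> nat \<Rightarrow> nat \<Rightarrow> complex \<Rightarrow> complex \<Rightarrow> complex" where
  "hardy_part k s E n N c z =
     - c * (1 - cayley k z) ^ s * poly E (cayley k z) * cayley k z ^ (N - n) / (1 - c * cayley k z ^ N)"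

text \<open>At height at most 1, the Cayley image \<open>a\<close> of \<open>z\<close> approaches \<open>b\<close> nontangentially, so
  \<open>\<bar>1 - c * a ^ N\<bar>\<close> is comparable to \<open>\<bar>1 - c * b ^ N\<bar>\<close>, and replacing \<open>E(a)\<close> by \<open>E(b)\<close> costs
  \<open>O(1 - \<bar>a\<bar>)\<close>, which the factor \<open>\<bar>a\<bar> ^ (N - n)\<close> turns into \<open>O(1 / N)\<close>. At greater height the
  comparison fails, because the cone also runs into the point 1 of the circle, the image of infinity,
  far from \<open>b\<close>; there \<open>\<bar>a\<bar> ^ (N - n) / (1 - \<bar>a\<bar> ^ N)\<close> is \<open>O(\<bar>z + k * \<i>\<bar>\<^sup>2 / N)\<close>, and two of the factors
  \<open>1 - a\<close> pay for it. Beyond its boundary value, \<open>E\<close> enters only through \<open>L\<close>, in the error term.\<close>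
lemma hardy_part_cone_bound:
  fixes E :: "complex poly"
  assumes k: "\<bar>k\<bar> = 1" and s: "s \<ge> 2"
    and L: "\<And>a. norm a \<le> 1 \<Longrightarrow> norm (poly E a) \<le> L"
      "\<And>a b. norm a \<le> 1 \<Longrightarrow> norm b \<le> 1 \<Longrightarrow> norm (poly E a - poly E b) \<le> L * norm (a - b)"
    and N: "N \<ge> 2 * n" "n \<ge> 1" and c: "norm c = 1"
    and \<alpha>: "\<alpha> > 0" and z: "z \<in> stolz_cone k \<alpha> x"
    and b: "b = cayley k (of_real x)" and pole: "c * b ^ N \<noteq> 1"
  shows "norm (hardy_part k s E n N c z) \<le> 2 * (2 + \<alpha>) ^ (s + 4) *
      ((norm ((1 - b) ^ s * poly E b) + 8 * L / N * norm (1 - b) ^ (s - 2)) / norm (1 - c * b ^ N))"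
proof -
  define a where "a = cayley k z"
  define r where "r = norm a"
  define Y where "Y = k * Im z"
  define D where "D = norm (z + of_real k * \<i>)"
  define X where "X = norm (of_real x + of_real k * \<i>)"
  define \<kappa> where "\<kappa> = (2 + \<alpha>)\<^sup>2"
  define d where "d = norm (1 - b)"
  note cone = cone_comparison[OF k \<alpha> z, folded D_def X_def Y_def]
  have Y: "Y > 0" by (fact cone(3))
  have L0: "L \<ge> 0" using L(1)[of 0] norm_ge_zero order_trans by (metis norm_zero zero_le_one)
  have nb: "norm b = 1" using norm_cayley_of_real[OF k] b by simp
  have r: "0 \<le> r" "r < 1" using norm_cayley_less[OF k cone(3)[unfolded Y_def]] by (auto simp: r_def a_def)
  have D: "D > 0" using add_nonzero[OF k, of z] Y by (simp add: D_def Y_def)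
  have na: "norm (1 - a) = 2 / D"
    unfolding a_def D_def using Y by (intro norm_one_minus_cayley k) (simp add: Y_def)
  have nb1: "d = 2 / X"
    unfolding b d_def X_def by (intro norm_one_minus_cayley k) simp
  have X: "X \<ge> 1"
    using norm_add_ge[OF k, of "of_real x"] by (simp add: X_def)
  have d: "0 < d" "d \<le> 2" using X by (auto simp: nb1 divide_le_eq intro!: divide_pos_pos)
  have ad: "norm (1 - a) \<le> (2 + \<alpha>) * d"
    using cone(1) X D by (simp add: na nb1 field_simps)
  have oneminus: "2 * Y / D\<^sup>2 \<le> 1 - r"
    unfolding r_def a_def D_def Y_def using Y
    by (intro one_minus_norm_cayley_ge k) (simp add: Y_def)
  have N0: "real N > 0" "n < N" using N by auto
  have rN: "r ^ N < 1" using r N0 by (simp add: power_less_one_iff)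
  have den_low: "1 - r ^ N \<le> norm (1 - c * a ^ N)"
    using norm_triangle_ineq2[of 1 "c * a ^ N"] c by (simp add: r_def norm_mult norm_power)
  have den_pos: "norm (1 - c * a ^ N) > 0" using den_low rN by linarith
  have den_b: "norm (1 - c * b ^ N) > 0" using pole by auto
  have half: "real N / 2 \<le> real (Suc (N - n))" using N by linarith
  have r_small: "r ^ (N - n) * (1 - r) * (real N / 2) \<le> 1 - r ^ N"
  proof -
    have "r ^ (N - n) * (1 - r) * (real N / 2) \<le> r ^ (N - n) * (1 - r) * real (Suc (N - n))"
      using half r by (intro mult_left_mono) auto
    also have "\<dots> \<le> 1 - r ^ N"
      using power_times_one_minus_le[of r "N - n" N] r N by (simp add: mult_ac)
    finally show ?thesis .
  qed
  have G: "norm (hardy_part k s E n N c z)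
      = norm (1 - a) ^ s * norm (poly E a) * r ^ (N - n) / norm (1 - c * a ^ N)"
    using c by (simp add: hardy_part_def a_def r_def norm_mult norm_divide norm_power)
  define M where "M = norm ((1 - b) ^ s * poly E b) + 8 * L / N * d ^ (s - 2)"
  have M0: "M \<ge> 0" using L0 d by (auto simp: M_def)
  have dd: "d ^ s \<le> 4 * d ^ (s - 2)"
  proof -
    have "d ^ s = d\<^sup>2 * d ^ (s - 2)" using s by (metis le_add_diff_inverse power_add)
    also have "\<dots> \<le> 2\<^sup>2 * d ^ (s - 2)" using d by (intro mult_right_mono power_mono) auto
    finally show ?thesis by simp
  qed
  have \<kappa>: "\<kappa> \<ge> 1" using \<alpha> by (simp add: \<kappa>_def)
  have "norm (hardy_part k s E n N c z) \<le> 2 * (2 + \<alpha>) ^ (s + 4) * (M / norm (1 - c * b ^ N))"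
  proof (cases "Y \<le> 1")
    case True
    \<comment> \<open>Nontangential approach in the disc; bounded height is used in \<open>cone(4)\<close>.\<close>
    have ab: "norm (a - b) \<le> \<kappa> * (1 - r)"
    proof -
      have "norm (a - b) = 2 * norm (z - of_real x) / (D * X)"
        using k Y add_nonzero[OF k, of z] add_nonzero[OF k, of "of_real x"]
        by (simp add: a_def b cayley_diff norm_divide norm_mult D_def X_def Y_def)
      also have "\<dots> \<le> 2 * ((1 + \<alpha>) * Y) / (D * (D / (2 + \<alpha>)))"
        using cone(2) cone(4) True D X \<alpha> Y mult_pos_pos[OF Y \<alpha>]
        by (intro frac_le mult_left_mono mult_pos_pos) (auto simp: field_simps)
      also have "\<dots> = (1 + \<alpha>) * (2 + \<alpha>) * (2 * Y / D\<^sup>2)"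
        using \<alpha> by (simp add: power2_eq_square)
      also have "\<dots> \<le> \<kappa> * (1 - r)"
        using oneminus \<alpha> r Y D
        by (intro mult_mono) (auto simp: \<kappa>_def power2_eq_square algebra_simps)
      finally show ?thesis .
    qed
    have den: "norm (1 - c * b ^ N) \<le> (1 + \<kappa>) * norm (1 - c * a ^ N)"
    proof -
      have "1 - c * b ^ N = (1 - c * a ^ N) + c * (a ^ N - b ^ N)" by (simp add: algebra_simps)
      then have "norm (1 - c * b ^ N) \<le> norm (1 - c * a ^ N) + norm (a ^ N - b ^ N)"
        using c by (metis norm_triangle_ineq norm_mult mult_1)
      also have "\<dots> \<le> norm (1 - c * a ^ N) + \<kappa> * (1 - r ^ N)"
        using norm_power_diff_le[OF nb, of a \<kappa> N] r ab by (simp add: r_def)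
      also have "\<dots> \<le> norm (1 - c * a ^ N) + \<kappa> * norm (1 - c * a ^ N)"
        using den_low \<kappa> by (intro add_left_mono mult_left_mono) auto
      finally show ?thesis by (simp add: algebra_simps)
    qed
    have E: "norm (poly E a) * r ^ (N - n) \<le> \<kappa> * (norm (poly E b) + 2 * L / N)"
    proof -
      have "norm (poly E a) \<le> norm (poly E b) + norm (poly E a - poly E b)"
        using norm_triangle_sub by blast
      also have "\<dots> \<le> norm (poly E b) + L * (\<kappa> * (1 - r))"
        using L(2)[of a b] nb r ab L0 by (intro add_left_mono order_trans[OF L(2)] mult_left_mono) (auto simp: r_def)
      finally have "norm (poly E a) * r ^ (N - n) \<le> (norm (poly E b) + L * (\<kappa> * (1 - r))) * r ^ (N - n)"
        using r by (intro mult_right_mono) auto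
      also have "\<dots> = norm (poly E b) * r ^ (N - n) + L * \<kappa> * (r ^ (N - n) * (1 - r))"
        by (simp add: algebra_simps)
      also have "\<dots> \<le> norm (poly E b) * 1 + L * \<kappa> * (2 / N)"
      proof (intro add_mono mult_left_mono)
        show "r ^ (N - n) \<le> 1" using r by (simp add: power_le_one)
        have "r ^ (N - n) * (1 - r) * (real N / 2) \<le> 1"
          using r_small r by (smt (verit) zero_le_power)
        then show "r ^ (N - n) * (1 - r) \<le> 2 / N" using N0 by (simp add: field_simps)
      qed (use L0 \<kappa> in auto)
      also have "\<dots> \<le> \<kappa> * norm (poly E b) + L * \<kappa> * (2 / N)"
        using \<kappa> by (simp add: mult_right_mono[of 1 \<kappa>, simplified])
      finally show ?thesis by (simp add: algebra_simps)
    qed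
    have "norm (hardy_part k s E n N c z)
        \<le> ((2 + \<alpha>) * d) ^ s * (\<kappa> * (norm (poly E b) + 2 * L / N)) / (norm (1 - c * b ^ N) / (1 + \<kappa>))"
      unfolding G mult.assoc
    proof (rule frac_le)
      show "norm (1 - c * b ^ N) / (1 + \<kappa>) \<le> norm (1 - c * a ^ N)"
        using den \<kappa> by (simp add: field_simps)
      show "norm (1 - a) ^ s * (norm (poly E a) * r ^ (N - n))
          \<le> ((2 + \<alpha>) * d) ^ s * (\<kappa> * (norm (poly E b) + 2 * L / N))"
        by (rule mult_mono[OF power_mono[OF ad] E]) (use r \<alpha> d in auto)
    qed (use \<kappa> \<alpha> d L0 den_b in auto)
    also have "\<dots> = (2 + \<alpha>) ^ s * (\<kappa> * (1 + \<kappa>)) * ((d ^ s * norm (poly E b) + 2 * L / N * d ^ s) / norm (1 - c * b ^ N))"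
    proof -
      have "t * y * (\<kappa> * (e + l)) / (m / w) = t * (\<kappa> * w) * ((y * e + l * y) / m)"
        for t y e l m w :: real
        by (simp add: algebra_simps add_divide_distrib)
      then show ?thesis by (simp only: power_mult_distrib)
    qed
    also have "\<dots> \<le> 2 * (2 + \<alpha>) ^ (s + 4) * (M / norm (1 - c * b ^ N))"
    proof (rule mult_mono[OF _ divide_right_mono])
      have "(2 + \<alpha>) ^ s * (\<kappa> * (1 + \<kappa>)) \<le> (2 + \<alpha>) ^ s * (\<kappa> * (2 * \<kappa>))"
        using \<kappa> \<alpha> by (intro mult_left_mono) auto
      also have "\<dots> = 2 * (2 + \<alpha>) ^ (s + 4)"
        by (simp add: \<kappa>_def power_add power2_eq_square power4_eq_xxxx)
      finally show "(2 + \<alpha>) ^ s * (\<kappa> * (1 + \<kappa>)) \<le> 2 * (2 + \<alpha>) ^ (s + 4)" .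
      have "2 * L / N * d ^ s \<le> 2 * L / N * (4 * d ^ (s - 2))"
        using dd L0 by (intro mult_left_mono) auto
      then show "d ^ s * norm (poly E b) + 2 * L / N * d ^ s \<le> M"
        by (simp add: M_def d_def norm_mult norm_power)
    qed (use \<alpha> d L0 in auto)
    finally show ?thesis .
  next
    case False
    \<comment> \<open>Here \<open>1 - r\<close> is at least \<open>2 / D\<^sup>2\<close>, because the height exceeds 1.\<close>
    have "r ^ (N - n) / norm (1 - c * a ^ N) \<le> D\<^sup>2 / N"
    proof -
      have "2 * 1 / D\<^sup>2 \<le> 2 * Y / D\<^sup>2" using False D by (intro divide_right_mono) auto
      then have r1: "2 / D\<^sup>2 \<le> 1 - r" using oneminus by simp
      have "r ^ (N - n) * (2 / D\<^sup>2) * (real N / 2) \<le> r ^ (N - n) * (1 - r) * (real N / 2)"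
        using r1 r by (intro mult_right_mono mult_left_mono) auto
      also have "\<dots> \<le> norm (1 - c * a ^ N)" using r_small den_low by linarith
      finally have "r ^ (N - n) * N \<le> norm (1 - c * a ^ N) * D\<^sup>2" using D by (simp add: field_simps)
      then show ?thesis using den_pos N0 by (simp add: field_simps)
    qed
    moreover have "norm (hardy_part k s E n N c z) = norm (1 - a) ^ s * norm (poly E a) * (r ^ (N - n) / norm (1 - c * a ^ N))"
      by (simp add: G)
    ultimately have "norm (hardy_part k s E n N c z) \<le> norm (1 - a) ^ s * L * (D\<^sup>2 / N)"
      using L(1)[of a] r L0 den_pos
      by (simp only:, intro mult_mono) (auto simp: r_def)
    also have "\<dots> = 4 * L / N * norm (1 - a) ^ (s - 2)"
    proof -
      have "norm (1 - a) ^ s = (norm (1 - a))\<^sup>2 * norm (1 - a) ^ (s - 2)"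
        using s by (metis le_add_diff_inverse power_add)
      also have "(norm (1 - a))\<^sup>2 = 4 / D\<^sup>2" by (simp add: na power_divide)
      finally show ?thesis using D by simp
    qed
    also have "\<dots> \<le> 4 * L / N * ((2 + \<alpha>) * d) ^ (s - 2)"
      using ad L0 by (intro mult_left_mono power_mono) auto
    also have "\<dots> \<le> (2 + \<alpha>) ^ (s - 2) * (8 * L / N * d ^ (s - 2) / 2)"
      by (simp add: power_mult_distrib mult_ac)
    also have "\<dots> \<le> (2 * (2 + \<alpha>) ^ (s + 4)) * (M / norm (1 - c * b ^ N))"
    proof (rule mult_mono[OF _ frac_le])
      show "norm (1 - c * b ^ N) \<le> 2"
        using norm_triangle_ineq4[of 1 "c * b ^ N"] c nb by (simp add: norm_mult norm_power)
      have "(2 + \<alpha>) ^ (s - 2) \<le> (2 + \<alpha>) ^ (s + 4)" using \<alpha> by (intro power_increasing) auto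
      moreover have "(2 + \<alpha>) ^ (s + 4) \<ge> 0" using \<alpha> by auto
      ultimately show "(2 + \<alpha>) ^ (s - 2) \<le> 2 * (2 + \<alpha>) ^ (s + 4)" by linarith
    qed (use \<alpha> d L0 den_b M0 in \<open>auto simp: M_def\<close>)
    finally show ?thesis .
  qed
  then show ?thesis by (simp add: M_def d_def)
qed

section \<open>Rationality, the splitting identity and the choice of rotation\<close>

text \<open>Cancelling the greatest common divisor fills in removable singularities only, so the reduced
  quotient agrees with the original one wherever the denominator does not vanish.\<close>
lemma rational_function_of_quotient:
  fixes a b :: "complex poly"
  assumes "b \<noteq> 0"
  obtains P where "rational_function P"
    "\<And>z. poly b z \<noteq> 0 \<Longrightarrow> P z = poly a z / poly b z \<and> P field_differentiable at z"
proof -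
  obtain a' b' where ab: "a = a' * gcd a b" "b = b' * gcd a b" "coprime a' b'"
    using gcd_coprime_exists[of a b] assms by auto
  have b': "b' \<noteq> 0" using ab(2) assms by auto
  show thesis
  proof (rule that[of "\<lambda>z. poly a' z / poly b' z"])
    show "rational_function (\<lambda>z. poly a' z / poly b' z)"
      unfolding rational_function_def using b' ab(3) by blast
    fix z assume z: "poly b z \<noteq> 0"
    have A: "poly a z = poly a' z * poly (gcd a b) z" using ab(1) by (metis poly_mult)
    have B: "poly b z = poly b' z * poly (gcd a b) z" using ab(2) by (metis poly_mult)
    have "poly b' z \<noteq> 0" using B z by auto
    moreover have "poly q field_differentiable at z" for q :: "complex poly"
      unfolding field_differentiable_def using poly_DERIV by blast
    ultimately show "poly a' z / poly b' z = poly a z / poly b z \<and>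
        (\<lambda>z. poly a' z / poly b' z) field_differentiable at z"
      using A B z by (auto intro!: field_differentiable_divide)
  qed
qed

text \<open>Homogenization of \<open>E\<close> clears the denominators of the Cayley coordinate.\<close>
lemma poly_cayley_quotient:
  obtains h :: "complex poly" and d :: nat where
    "\<And>z. z + of_real k * \<i> \<noteq> 0 \<Longrightarrow> poly E (cayley k z) = poly h z / (z + of_real k * \<i>) ^ d"
proof -
  have "\<exists>(h :: complex poly) d. \<forall>z. z + of_real k * \<i> \<noteq> 0 \<longrightarrow>
      poly E (cayley k z) = poly h z / (z + of_real k * \<i>) ^ d"
  proof (induction E)
    case (pCons e E)
    then obtain h :: "complex poly" and d where
      h: "\<And>z. z + of_real k * \<i> \<noteq> 0 \<Longrightarrow> poly E (cayley k z) = poly h z / (z + of_real k * \<i>) ^ d"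
      by blast
    show ?case
    proof (intro exI[of _ "smult e ([:of_real k * \<i>, 1:] ^ Suc d) + [:- of_real k * \<i>, 1:] * h"]
        exI[of _ "Suc d"] allI impI)
      fix z assume z: "z + of_real k * \<i> \<noteq> 0"
      have *: "e + M / D * (H / W) = (e * (D * W) + M * H) / (D * W)"
        if "W \<noteq> 0" "D \<noteq> 0" for H W M D :: complex using that by (simp add: add_divide_distrib)
      have DM: "poly [:of_real k * \<i>, 1:] z = z + of_real k * \<i>"
        "poly [:- of_real k * \<i>, 1:] z = z - of_real k * \<i>" by simp_all
      have "poly (pCons e E) (cayley k z)
          = e + (z - of_real k * \<i>) / (z + of_real k * \<i>) * (poly h z / (z + of_real k * \<i>) ^ d)"
        unfolding h[OF z, symmetric] by (simp add: cayley_def)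
      then show "poly (pCons e E) (cayley k z)
          = poly (smult e ([:of_real k * \<i>, 1:] ^ Suc d) + [:- of_real k * \<i>, 1:] * h) z
            / (z + of_real k * \<i>) ^ Suc d"
        using z by (simp only: * DM power_not_zero poly_add poly_smult poly_mult poly_power power_Suc
            not_False_eq_True)
    qed
  qed (auto intro: exI[of _ 0])
  with that show thesis by blast
qed

lemma hardy_part_rational:
  assumes "\<bar>k\<bar> = 1" "n \<le> N" "N \<ge> 1"
  obtains P where "rational_function P"
    "finite {z. z + of_real k * \<i> = 0 \<or> c * cayley k z ^ N = 1}"
    "\<And>z. z + of_real k * \<i> \<noteq> 0 \<Longrightarrow> c * cayley k z ^ N \<noteq> 1 \<Longrightarrow>
      P z = hardy_part k s E n N c z \<and> P field_differentiable at z"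
proof -
  obtain h :: "complex poly" and d where
    h: "\<And>z. z + of_real k * \<i> \<noteq> 0 \<Longrightarrow> poly E (cayley k z) = poly h z / (z + of_real k * \<i>) ^ d"
    using poly_cayley_quotient by blast
  define pD where "pD = [:of_real k * \<i>, 1:]"
  define pM where "pM = [:- of_real k * \<i>, 1:]"
  define a where "a = smult (- c * (2 * of_real k * \<i>) ^ s) (h * pM ^ (N - n) * pD ^ n)"
  define b where "b = pD ^ (s + d) * (pD ^ N - smult c (pM ^ N))"
  have D: "poly pD z = z + of_real k * \<i>" and M: "poly pM z = z - of_real k * \<i>" for z
    by (simp_all add: pD_def pM_def)
  \<comment> \<open>At \<open>k * \<i>\<close>, the preimage of the centre of the disc, the second factor of \<open>b\<close> reduces to a power of \<open>2 * k * \<i>\<close>.\<close>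
  have "poly b (of_real k * \<i>) \<noteq> 0"
    using assms by (auto simp: b_def D M power_0_left)
  then have b: "b \<noteq> 0" by auto
  have b0: "poly b z \<noteq> 0 \<longleftrightarrow> z + of_real k * \<i> \<noteq> 0 \<and> c * cayley k z ^ N \<noteq> 1" 
    if "z + of_real k * \<i> \<noteq> 0" for z
    using that by (auto simp: b_def D M cayley_def power_divide field_simps)
  have "{z. z + of_real k * \<i> = 0 \<or> c * cayley k z ^ N = 1}
      \<subseteq> insert (- of_real k * \<i>) {z. poly b z = 0}"
    using b0 by (auto simp: eq_neg_iff_add_eq_0)
  then have fin: "finite {z. z + of_real k * \<i> = 0 \<or> c * cayley k z ^ N = 1}"
    using poly_roots_finite[OF b] by (rule finite_subset[OF _ finite.insertI])
  obtain P where P: "rational_function P"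
    "\<And>z. poly b z \<noteq> 0 \<Longrightarrow> P z = poly a z / poly b z \<and> P field_differentiable at z"
    using rational_function_of_quotient[OF b, of a] by blast
  show thesis
  proof (rule that[OF P(1) fin])
    fix z assume z: "z + of_real k * \<i> \<noteq> 0" "c * cayley k z ^ N \<noteq> 1"
    have z': "poly b z \<noteq> 0" using b0 z by blast
    define V where "V = z + of_real k * \<i>"
    define W where "W = z - of_real k * \<i>"
    have V: "V \<noteq> 0" using z by (simp add: V_def)
    have VN: "V ^ N = V ^ (N - n) * V ^ n" using assms by (simp flip: power_add)
    have den: "1 - c * W ^ N / V ^ N \<noteq> 0" using z V by (simp add: cayley_def V_def W_def power_divide)
    have den': "V ^ N - c * W ^ N = V ^ N * (1 - c * W ^ N / V ^ N)"
      using V by (simp add: field_simps)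
    have "poly a z / poly b z
        = - c * (2 * of_real k * \<i>) ^ s * (poly h z * W ^ (N - n) * V ^ n) /
            (V ^ s * V ^ d * (V ^ N * (1 - c * W ^ N / V ^ N)))"
      unfolding den'[symmetric]
      by (simp only: a_def b_def poly_smult poly_mult poly_power poly_diff D M power_add
          V_def W_def)
    also have "\<dots> = - c * ((2 * of_real k * \<i>) ^ s / V ^ s) * (poly h z / V ^ d) * (W ^ (N - n) / V ^ (N - n)) /
            (1 - c * W ^ N / V ^ N)"
      using V den unfolding VN by (simp add: divide_simps)
    also have "\<dots> = hardy_part k s E n N c z"
      unfolding hardy_part_def one_minus_cayley[OF z(1)] h[OF z(1)]
      by (simp add: cayley_def V_def W_def power_divide)
    finally show "P z = hardy_part k s E n N c z \<and> P field_differentiable at z"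
      using P(2)[OF z'] by simp
  qed
qed

text \<open>The identity \<open>1 = - w / (1 - w) - w\<^sup>-\<^sup>1 / (1 - w\<^sup>-\<^sup>1)\<close> behind the splitting.\<close>
lemma hardy_parts_add:
  fixes x :: real
  defines "u \<equiv> cayley 1 (of_real x)" and "v \<equiv> cayley (-1) (of_real x)"
  assumes "norm c = 1" "n \<le> N" "m \<le> N" "c * u ^ N \<noteq> 1"
    and R: "R = (1 - u) ^ s * poly E u / u ^ n" "R = (1 - v) ^ s * poly E' v / v ^ m"
  shows "hardy_part 1 s E n N c (of_real x) + hardy_part (-1) s E' m N (cnj c) (of_real x) = R"
proof -
  define w where "w = c * u ^ N"
  have u: "norm u = 1" "u \<noteq> 0" using norm_cayley_of_real[of 1 x] by (auto simp: u_def)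
  have v: "v = inverse u" by (simp add: u_def v_def cayley_uminus)
  have c: "c \<noteq> 0" "cnj c = inverse c"
    using assms(3) complex_norm_square[of c] by (auto intro!: inverse_unique[symmetric])
  have w: "w \<noteq> 0" "w \<noteq> 1" "cnj c * v ^ N = inverse w"
    using assms(6) by (simp_all add: w_def v c u power_inverse)
  have 1: "hardy_part 1 s E n N c (of_real x) = - w * R / (1 - w)"
  proof -
    have "u ^ N = u ^ (N - n) * u ^ n" using assms by (simp flip: power_add)
    then show ?thesis using u by (simp add: hardy_part_def R(1) w_def flip: u_def)
  qed
  have 2: "hardy_part (-1) s E' m N (cnj c) (of_real x) = - inverse w * R / (1 - inverse w)"
  proof -
    have "v ^ N = v ^ (N - m) * v ^ m" using assms(5) by (simp flip: power_add)
    moreover have "v \<noteq> 0" using u(2) unfolding v by (rule nonzero_imp_inverse_nonzero)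
    ultimately show ?thesis unfolding w(3)[symmetric] by (simp add: hardy_part_def R(2) flip: v_def)
  qed
  have 3: "- inverse w * R / (1 - inverse w) = R / (1 - w)"
  proof -
    have "1 - inverse w = - inverse w * (1 - w)" using w(1) by (simp add: field_simps)
    then show ?thesis using mult_divide_mult_cancel_left[of "- inverse w" R "1 - w"] w(1) by simp
  qed
  have "- w * R / (1 - w) + R / (1 - w) = (1 - w) * R / (1 - w)"
    by (simp add: algebra_simps flip: add_divide_distrib)
  then show ?thesis unfolding 1 2 3 using w(2) by simp
qed

text \<open>After projection to the imaginary axis, with \<open>b = Im v\<close>, this bounds the mean of \<open>\<bar>c - v\<bar>\<^sup>-\<^sup>p\<close>
  over an arc of unimodular \<open>c\<close>; it is the place where \<open>p < 1\<close> is essential.\<close>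
lemma nn_integral_powr_distance_le:
  fixes p b :: real
  assumes "0 < p" "p < 1" "\<bar>b\<bar> \<le> 1"
  shows "(\<integral>\<^sup>+ t. indicator {0..1} t * ennreal (\<bar>t - b\<bar> powr (- p)) \<partial>lborel) \<le> ennreal (4 / (1 - p))"
proof -
  let ?f = "\<lambda>t. ennreal (\<bar>t\<bar> powr (- p))"
  have half: "(\<integral>\<^sup>+ t. ?f t * indicator {0..2} t \<partial>lborel) = ennreal (2 powr (1 - p) / (1 - p))"
  proof -
    have "((\<lambda>t. t powr (- p)) has_integral (2 powr (- p + 1) / (- p + 1))) {0..2::real}"
      using assms by (intro has_integral_powr_from_0) auto
    from nn_integral_has_integral_lebesgue'[OF _ this]
    have "(\<integral>\<^sup>+ t. ennreal (t powr (- p)) * indicator {0..2} t \<partial>lborel) = ennreal (2 powr (1 - p) / (1 - p))"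
      by simp
    moreover have "ennreal (t powr (- p)) * indicator {0..2} t = ?f t * indicator {0..2} t" for t
      by (auto simp: indicator_def)
    ultimately show ?thesis by simp
  qed
  have "(\<integral>\<^sup>+ t. indicator {0..1} t * ennreal (\<bar>t - b\<bar> powr (- p)) \<partial>lborel)
      = (\<integral>\<^sup>+ t. indicator {0..1} (b + t) * ?f t \<partial>lborel)"
    by (subst nn_integral_real_affine[where c = 1 and t = b]) auto
  also have "\<dots> \<le> (\<integral>\<^sup>+ t. ?f t * indicator {0..2} t + ?f t * indicator {0..2} (- t) \<partial>lborel)"
    using assms by (intro nn_integral_mono) (auto simp: indicator_def)
  also have "\<dots> = (\<integral>\<^sup>+ t. ?f t * indicator {0..2} t \<partial>lborel) + (\<integral>\<^sup>+ t. ?f t * indicator {0..2} (- t) \<partial>lborel)"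
    by (rule nn_integral_add) auto
  also have "(\<integral>\<^sup>+ t. ?f t * indicator {0..2} (- t) \<partial>lborel) = (\<integral>\<^sup>+ t. ?f t * indicator {0..2} t \<partial>lborel)"
    by (subst nn_integral_real_affine[where c = "-1" and t = 0]) auto
  also have "(\<integral>\<^sup>+ t. ?f t * indicator {0..2} t \<partial>lborel) + (\<integral>\<^sup>+ t. ?f t * indicator {0..2} t \<partial>lborel)
      = ennreal (2 * (2 powr (1 - p) / (1 - p)))"
    unfolding half using assms by (simp flip: ennreal_plus)
  also have "\<dots> \<le> ennreal (4 / (1 - p))"
  proof (rule ennreal_leI)
    have "(2::real) powr (1 - p) \<le> 2 powr 1" using assms by (intro powr_mono) auto
    then show "2 * (2 powr (1 - p) / (1 - p)) \<le> 4 / (1 - p)"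
      using assms by (simp add: divide_right_mono)
  qed
  finally show ?thesis .
qed

text \<open>Fubini: the mean over \<open>c\<close> of the integrals is controlled by \<open>nn_integral_powr_distance_le\<close> for
  each \<open>x\<close> separately, so some \<open>c\<close> does not exceed the mean by more than any given amount.\<close>
lemma exists_good_rotation:
  fixes a :: "real \<Rightarrow> real" and v :: "real \<Rightarrow> complex"
  assumes p: "0 < p" "p < 1"
    and meas[measurable]: "a \<in> borel_measurable borel" "v \<in> borel_measurable borel"
    and a: "\<And>x. 0 \<le> a x" and v: "\<And>x. norm (v x) = 1"
    and B: "ennreal (4 / (1 - p)) * (\<integral>\<^sup>+ x. ennreal (a x powr p) \<partial>lborel) < B"
  obtains c where "norm c = 1"
    "(\<integral>\<^sup>+ x. ennreal ((a x / norm (1 - c * v x)) powr p) \<partial>lborel) \<le> B"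
proof -
  \<comment> \<open>An arc of the circle, parametrized by the imaginary part \<open>t\<close> of the conjugate.\<close>
  define \<gamma> where "\<gamma> t = of_real (sqrt (1 - t\<^sup>2)) - \<i> * of_real t" for t :: real
  have [measurable]: "\<gamma> \<in> borel_measurable borel" unfolding \<gamma>_def by measurable
  have \<gamma>: "norm (\<gamma> t) = 1" if "t \<in> {0..1}" for t
  proof -
    have "t\<^sup>2 \<le> 1" using that by (simp add: power_le_one)
    then show ?thesis by (simp add: \<gamma>_def cmod_def)
  qed
  have dist: "\<bar>t - Im (v x)\<bar> \<le> norm (1 - \<gamma> t * v x)" if "t \<in> {0..1}" for t x
  proof -
    have "norm (1 - \<gamma> t * v x) = norm (cnj (\<gamma> t) * (1 - \<gamma> t * v x))"
      using \<gamma>[OF that] by (simp add: norm_mult)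
    also have "cnj (\<gamma> t) * (1 - \<gamma> t * v x) = cnj (\<gamma> t) - v x"
    proof -
      have "cnj (\<gamma> t) * \<gamma> t = 1"
        using \<gamma>[OF that] complex_norm_square[of "\<gamma> t"] by (simp add: mult.commute)
      moreover have "cnj (\<gamma> t) * (1 - \<gamma> t * v x) = cnj (\<gamma> t) - cnj (\<gamma> t) * \<gamma> t * v x"
        by (simp add: right_diff_distrib mult.assoc)
      ultimately show ?thesis by simp
    qed
    also have "norm (cnj (\<gamma> t) - v x) \<ge> \<bar>Im (cnj (\<gamma> t) - v x)\<bar>" by (rule abs_Im_le_cmod)
    finally show ?thesis by (simp add: \<gamma>_def)
  qed
  let ?I = "\<lambda>t. \<integral>\<^sup>+ x. ennreal ((a x / norm (1 - \<gamma> t * v x)) powr p) \<partial>lborel"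
  have "\<exists>t\<in>{0..1}. ?I t \<le> B"
  proof (rule ccontr)
    assume "\<not> ?thesis"
    then have big: "B \<le> ?I t" if "t \<in> {0..1}" for t using that by force
    have "B = (\<integral>\<^sup>+ t. indicator {0..1::real} t * B \<partial>lborel)"
      by (simp add: nn_integral_multc)
    also have "\<dots> \<le> (\<integral>\<^sup>+ t. indicator {0..1} t * ?I t \<partial>lborel)"
      using big by (intro nn_integral_mono) (auto simp: indicator_def)
    also have "\<dots> = (\<integral>\<^sup>+ t. (\<integral>\<^sup>+ x. indicator {0..1} t * ennreal ((a x / norm (1 - \<gamma> t * v x)) powr p) \<partial>lborel) \<partial>lborel)"
      by (intro nn_integral_cong nn_integral_cmult[symmetric]) measurable
    also have "\<dots> = (\<integral>\<^sup>+ x. (\<integral>\<^sup>+ t. indicator {0..1} t * ennreal ((a x / norm (1 - \<gamma> t * v x)) powr p) \<partial>lborel) \<partial>lborel)"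
      by (rule lborel_pair.Fubini'[symmetric]) measurable
    also have "\<dots> \<le> (\<integral>\<^sup>+ x. ennreal (4 / (1 - p)) * ennreal (a x powr p) \<partial>lborel)"
    proof (rule nn_integral_mono)
      fix x
      have b: "\<bar>Im (v x)\<bar> \<le> 1" using abs_Im_le_cmod[of "v x"] v[of x] by simp
      have "(\<integral>\<^sup>+ t. indicator {0..1} t * ennreal ((a x / norm (1 - \<gamma> t * v x)) powr p) \<partial>lborel)
        \<le> (\<integral>\<^sup>+ t. ennreal (a x powr p) * (indicator {0..1} t * ennreal (\<bar>t - Im (v x)\<bar> powr (- p))) \<partial>lborel)"
      proof (rule nn_integral_mono_AE)
        have "AE t in lborel. t \<noteq> Im (v x)" by (rule AE_lborel_singleton)
        then show "AE t in lborel. indicator {0..1} t * ennreal ((a x / norm (1 - \<gamma> t * v x)) powr p)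
          \<le> ennreal (a x powr p) * (indicator {0..1} t * ennreal (\<bar>t - Im (v x)\<bar> powr (- p)))"
        proof eventually_elim
          case (elim t)
          show ?case
          proof (cases "t \<in> {0..1}")
            case True
            have "(a x / norm (1 - \<gamma> t * v x)) powr p \<le> (a x / \<bar>t - Im (v x)\<bar>) powr p"
              using dist[OF True, of x] elim p a[of x]
              by (intro powr_mono2 divide_left_mono) (auto intro!: divide_nonneg_nonneg mult_pos_pos)
            also have "\<dots> = a x powr p * \<bar>t - Im (v x)\<bar> powr (- p)"
              using a[of x] by (simp add: powr_divide powr_minus_divide)
            finally show ?thesis using True by (simp add: ennreal_leI flip: ennreal_mult)
          qed simp
        qed
      qed
      also have "\<dots> = ennreal (a x powr p) * (\<integral>\<^sup>+ t. indicator {0..1} t * ennreal (\<bar>t - Im (v x)\<bar> powr (- p)) \<partial>lborel)"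
        by (rule nn_integral_cmult) measurable
      also have "\<dots> \<le> ennreal (a x powr p) * ennreal (4 / (1 - p))"
        by (intro mult_left_mono nn_integral_powr_distance_le p b) auto
      finally show "(\<integral>\<^sup>+ t. indicator {0..1} t * ennreal ((a x / norm (1 - \<gamma> t * v x)) powr p) \<partial>lborel)
        \<le> ennreal (4 / (1 - p)) * ennreal (a x powr p)" by (simp add: mult.commute)
    qed
    also have "\<dots> = ennreal (4 / (1 - p)) * (\<integral>\<^sup>+ x. ennreal (a x powr p) \<partial>lborel)"
      by (rule nn_integral_cmult) measurable
    also have "\<dots> < B" by (rule B)
    finally show False by simp
  qed
  with \<gamma> that show thesis by blast
qed

section \<open>Approximation by trigonometric polynomials in the Cayley coordinate\<close>

text \<open>The functions to which the splitting applies. The exponent \<open>s\<close> controls the decay at infinity,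
  which for small \<open>p\<close> must be fast.\<close>
definition cayley_trig :: "nat \<Rightarrow> nat \<Rightarrow> complex poly \<Rightarrow> real \<Rightarrow> complex" where
  "cayley_trig s n E x =
     (1 - cayley 1 (of_real x)) ^ s * poly E (cayley 1 (of_real x)) / cayley 1 (of_real x) ^ n"

lemma continuous_cayley_of_real: "\<bar>k\<bar> = 1 \<Longrightarrow> continuous_on UNIV (\<lambda>x. cayley k (of_real x))"
  unfolding cayley_def using add_nonzero[of k "of_real _"] by (intro continuous_intros) auto

lemma borel_measurable_cayley_of_real [measurable]:
  "(\<lambda>x. cayley 1 (complex_of_real x)) \<in> borel_measurable borel"
  by (intro borel_measurable_continuous_onI continuous_cayley_of_real) simp

lemma borel_measurable_poly [measurable]:
  fixes E :: "complex poly"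
  shows "g \<in> borel_measurable M \<Longrightarrow> (\<lambda>x. poly E (g x)) \<in> borel_measurable M"
  by (rule borel_measurable_continuous_on[of "poly E"]) (auto intro: continuous_intros)

lemma borel_measurable_cayley_trig [measurable]: "cayley_trig s n E \<in> borel_measurable borel"
  unfolding cayley_trig_def by measurable

lemma nn_integral_inverse_one_plus_square_finite:
  "(\<integral>\<^sup>+ x. ennreal (1 / (1 + x\<^sup>2)) \<partial>lborel) < \<infinity>"
proof -
  let ?f = "\<lambda>x::real. ennreal (1 / (1 + x\<^sup>2))"
  have pos: "(\<integral>\<^sup>+ x. ?f x * indicator {0..} x \<partial>lborel) = ennreal (pi / 2 - arctan 0)"
  proof (rule nn_integral_FTC_atLeast)
    show "(arctan has_real_derivative 1 / (1 + x\<^sup>2)) (at x)" for x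
      by (auto intro!: derivative_eq_intros simp: inverse_eq_divide)
  qed (auto intro: tendsto_arctan_at_top)
  have "(\<integral>\<^sup>+ x. ?f x \<partial>lborel) \<le> (\<integral>\<^sup>+ x. ?f x * indicator {0..} x + ?f x * indicator {0..} (- x) \<partial>lborel)"
    by (intro nn_integral_mono) (auto simp: indicator_def)
  also have "\<dots> = (\<integral>\<^sup>+ x. ?f x * indicator {0..} x \<partial>lborel) + (\<integral>\<^sup>+ x. ?f x * indicator {0..} (- x) \<partial>lborel)"
    by (rule nn_integral_add) auto
  also have "(\<integral>\<^sup>+ x. ?f x * indicator {0..} (- x) \<partial>lborel) = (\<integral>\<^sup>+ x. ?f x * indicator {0..} x \<partial>lborel)"
    by (subst nn_integral_real_affine[where c = "-1" and t = 0]) auto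
  also have "\<dots> + \<dots> < \<infinity>" unfolding pos by (simp flip: ennreal_plus)
  finally show ?thesis .
qed

lemma nn_integral_one_minus_cayley_finite:
  assumes "real q * p \<ge> 2"
  shows "(\<integral>\<^sup>+ x. ennreal ((norm (1 - cayley 1 (of_real x)) ^ q) powr p) \<partial>lborel) < \<infinity>"
proof -
  have le: "(norm (1 - cayley 1 (of_real x)) ^ q) powr p \<le> 2 powr (real q * p) * (1 / (1 + x\<^sup>2))" for x
  proof -
    define X where "X = norm (of_real x + of_real 1 * \<i>)"
    have X: "X \<ge> 1" "X\<^sup>2 = 1 + x\<^sup>2"
      using norm_add_ge[of 1 "of_real x"] norm_add_square[of 1 "of_real x"] by (simp_all add: X_def)
    have nX: "norm (1 - cayley 1 (of_real x)) = 2 * (1 / X)"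
      using norm_one_minus_cayley[of 1 "of_real x"] by (simp add: X_def)
    have "(norm (1 - cayley 1 (of_real x)) ^ q) powr p = (2 * (1 / X)) powr (real q * p)"
    proof -
      have "y ^ q = y powr real q" if "y > 0" for y :: real using powr_realpow[OF that] by simp
      moreover have "2 * (1 / X) > 0" using X by simp
      ultimately show ?thesis unfolding nX by (metis powr_powr)
    qed
    also have "\<dots> = 2 powr (real q * p) * (1 / X) powr (real q * p)"
      using X by (intro powr_mult)
    also have "\<dots> \<le> 2 powr (real q * p) * (1 / X) powr 2"
      using X assms by (intro mult_left_mono powr_mono') auto
    also have "(1 / X) powr 2 = 1 / (1 + x\<^sup>2)"
      using X by (simp add: power_divide flip: X(2))
    finally show ?thesis .
  qed
  have "(\<integral>\<^sup>+ x. ennreal ((norm (1 - cayley 1 (of_real x)) ^ q) powr p) \<partial>lborel)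
      \<le> (\<integral>\<^sup>+ x. ennreal (2 powr (real q * p)) * ennreal (1 / (1 + x\<^sup>2)) \<partial>lborel)"
    using le by (intro nn_integral_mono) (simp flip: ennreal_mult add: ennreal_leI)
  also have "\<dots> = ennreal (2 powr (real q * p)) * (\<integral>\<^sup>+ x. ennreal (1 / (1 + x\<^sup>2)) \<partial>lborel)"
    by (rule nn_integral_cmult) measurable
  also have "\<dots> < \<infinity>" using nn_integral_inverse_one_plus_square_finite
    by (simp add: ennreal_mult_less_top)
  finally show ?thesis .
qed

text \<open>On the circle the conjugate of \<open>u\<close> is \<open>1 / u\<close>, so polynomials in the two real coordinates are
  Laurent polynomials in \<open>u\<close>.\<close>
lemma real_polynomial_function_on_circle:
  fixes q :: "complex \<Rightarrow> real"
  assumes "real_polynomial_function q"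
  shows "\<exists>n E. \<forall>u. norm u = 1 \<longrightarrow> of_real (q u) = poly E u / u ^ n"
  using assms
proof (induction rule: real_polynomial_function.induct)
  case (linear f)
  \<comment> \<open>A real-linear \<open>f\<close> is \<open>\<alpha> * u + \<beta> * cnj u\<close>.\<close>
  define \<alpha> where "\<alpha> = (of_real (f 1) - \<i> * of_real (f \<i>)) / 2"
  define \<beta> where "\<beta> = (of_real (f 1) + \<i> * of_real (f \<i>)) / 2"
  have "of_real (f u) = poly [:\<beta>, 0, \<alpha>:] u / u ^ 1" if u: "norm u = 1" for u
  proof -
    interpret f: bounded_linear f by (rule linear)
    have "f u = f (Re u *\<^sub>R 1 + Im u *\<^sub>R \<i>)"
      by (rule arg_cong[of _ _ f]) (simp add: complex_eq_iff)
    then have fu: "f u = Re u * f 1 + Im u * f \<i>" by (simp only: f.add f.scaleR real_scaleR_def)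
    have u0: "u \<noteq> 0" "u * cnj u = 1" using u complex_norm_square[of u] by auto
    have "poly [:\<beta>, 0, \<alpha>:] u = (\<beta> * cnj u + \<alpha> * u) * u"
      using u0(2) by (simp add: algebra_simps)
    then have "poly [:\<beta>, 0, \<alpha>:] u / u ^ 1 = \<beta> * cnj u + \<alpha> * u" using u0(1) by simp
    also have "\<dots> = of_real (f u)"
      by (simp add: fu \<alpha>_def \<beta>_def complex_eq_iff algebra_simps add_divide_distrib diff_divide_distrib)
    finally show ?thesis by simp
  qed
  then show ?case by blast
next
  case (const c)
  have "of_real c = poly [:of_real c:] u / u ^ 0" for u :: complex by simp
  then show ?case by blast
next
  case (add f g)
  then obtain n E m E' where
    E: "\<And>u. norm u = 1 \<Longrightarrow> of_real (f u) = poly E u / u ^ n"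
    "\<And>u. norm u = 1 \<Longrightarrow> of_real (g u) = poly E' u / u ^ m" by blast
  have "of_real (f u + g u) = poly (E * monom 1 m + E' * monom 1 n) u / u ^ (n + m)"
    if u: "norm u = 1" for u
  proof -
    have "u \<noteq> 0" using u by auto
    then show ?thesis using E[OF u] by (simp add: poly_monom power_add field_simps)
  qed
  then show ?case by blast
next
  case (mult f g)
  then obtain n E m E' where
    E: "\<And>u. norm u = 1 \<Longrightarrow> of_real (f u) = poly E u / u ^ n"
    "\<And>u. norm u = 1 \<Longrightarrow> of_real (g u) = poly E' u / u ^ m" by blast
  have "of_real (f u * g u) = poly (E * E') u / u ^ (n + m)" if u: "norm u = 1" for u
    using E[OF u] by (simp add: power_add)
  then show ?case by blast
qed

lemma trigonometric_approximation_on_circle: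
  fixes f :: "complex \<Rightarrow> complex"
  assumes "continuous_on (sphere 0 1) f" "e > 0"
  obtains n E where "\<And>u. norm u = 1 \<Longrightarrow> norm (f u - poly E u / u ^ n) < e"
proof -
  obtain g where g: "polynomial_function g" "\<And>u. u \<in> sphere 0 1 \<Longrightarrow> norm (f u - g u) < e"
    using Stone_Weierstrass_polynomial_function[OF _ assms] by auto
  have "real_polynomial_function (Re \<circ> g)" "real_polynomial_function (Im \<circ> g)"
    using g(1) unfolding polynomial_function_def by (auto intro: bounded_linear_Re bounded_linear_Im)
  then obtain n E m E' where
    E: "\<And>u. norm u = 1 \<Longrightarrow> of_real (Re (g u)) = poly E u / u ^ n"
    "\<And>u. norm u = 1 \<Longrightarrow> of_real (Im (g u)) = poly E' u / u ^ m"
    using real_polynomial_function_on_circle[of "Re \<circ> g"] real_polynomial_function_on_circle[of "Im \<circ> g"]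
    by auto
  show thesis
  proof (rule that)
    fix u :: complex assume u: "norm u = 1"
    then have u0: "u \<noteq> 0" by auto
    have "g u = of_real (Re (g u)) + \<i> * of_real (Im (g u))" by (rule complex_eq)
    also have "\<dots> = poly (E * monom 1 m + smult \<i> (E' * monom 1 n)) u / u ^ (n + m)"
      using E[OF u] u0 by (simp add: poly_monom power_add field_simps)
    finally show "norm (f u - poly (E * monom 1 m + smult \<i> (E' * monom 1 n)) u / u ^ (n + m)) < e"
      using g(2)[of u] u by simp
  qed
qed

text \<open>A real form of the inverse Cayley map \<open>\<i> * (1 + u) / (1 - u)\<close>, with which it agrees on the unit
  circle.\<close>
lemma cayley_coordinate:
  fixes x :: real
  shows "- Im (cayley 1 (of_real x)) / (1 - Re (cayley 1 (of_real x))) = x"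
proof -
  have "1 + x\<^sup>2 > 0" by (simp add: add_pos_nonneg)
  then show ?thesis
    by (simp add: cayley_def Re_divide Im_divide power2_eq_square field_simps)
qed

text \<open>Compact support of \<open>h\<close> lets \<open>h / (1 - u) ^ s\<close> extend continuously by 0 to the point \<open>u = 1\<close> of the
  circle, where the Stone-Weierstrass theorem applies; multiplying back gives an error with the
  decay of \<open>(1 - u) ^ s\<close>.\<close>
lemma cayley_trig_approximation:
  fixes h :: "real \<Rightarrow> complex"
  assumes h: "continuous_on UNIV h" "\<And>x. \<bar>x\<bar> \<ge> M \<Longrightarrow> h x = 0" and M: "M > 0" and e: "e > 0" and s: "s > 0"
  obtains n E where
    "\<And>x. norm (h x - cayley_trig s n E x) \<le> e * norm (1 - cayley 1 (of_real x)) ^ s"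
proof -
  define f where "f u = h (- Im u / (1 - Re u)) / (1 - u) ^ s" for u
  have cont: "continuous_on (sphere 0 1) f"
    unfolding continuous_on_eq_continuous_within
  proof
    fix u :: complex assume u: "u \<in> sphere 0 1"
    show "continuous (at u within sphere 0 1) f"
    proof (cases "u = 1")
      case False
      have "Re u \<noteq> 1"
      proof
        assume "Re u = 1"
        moreover have "(Re u)\<^sup>2 + (Im u)\<^sup>2 = 1" using u cmod_power2[of u] by simp
        ultimately have "u = 1" by (simp add: complex_eq_iff)
        with False show False by simp
      qed
      then have "isCont (\<lambda>u. - Im u / (1 - Re u)) u" by (intro continuous_intros) auto
      moreover have "isCont h y" for y using h(1) by (simp add: continuous_on_eq_continuous_at)
      ultimately have "isCont (\<lambda>u. h (- Im u / (1 - Re u))) u" by (rule isCont_o2)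
      then have "isCont f u"
        unfolding f_def using False by (intro continuous_divide) (auto intro!: continuous_intros)
      then show ?thesis by (rule continuous_at_imp_continuous_at_within)
    next
      case True
      \<comment> \<open>Near 1 the real coordinate is at least \<open>M\<close> in modulus, since its square is \<open>(1 + Re u) / (1 - Re u)\<close>.\<close>
      have "((\<lambda>u. 1 - Re u) \<longlongrightarrow> 1 - Re 1) (at (1::complex) within sphere 0 1)"
        by (intro tendsto_intros)
      then have "\<forall>\<^sub>F u in at 1 within sphere (0::complex) 1. 1 - Re u < 2 / (1 + M\<^sup>2)"
        by (rule order_tendstoD) (simp add: add_pos_nonneg)
      moreover have "\<forall>\<^sub>F u in at 1 within sphere (0::complex) 1. u \<in> sphere 0 1 \<and> u \<noteq> 1"
        by (auto simp: eventually_at_filter)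
      ultimately have "\<forall>\<^sub>F u in at 1 within sphere 0 1. f u = 0"
      proof eventually_elim
        case (elim u)
        define t where "t = 1 - Re u"
        have nu: "(Re u)\<^sup>2 + (Im u)\<^sup>2 = 1" using elim cmod_power2[of u] by simp
        have "t \<noteq> 0"
          using elim nu by (auto simp: t_def complex_eq_iff)
        moreover have "Re u \<le> 1" using complex_Re_le_cmod[of u] elim by simp
        ultimately have t: "t > 0" by (simp add: t_def)
        have "(Im u)\<^sup>2 = t * (2 - t)" using nu by (simp add: t_def power2_eq_square algebra_simps)
        moreover have "M\<^sup>2 * t \<le> 2 - t"
        proof -
          have "t < 2 / (1 + M\<^sup>2)" "1 + M\<^sup>2 > 0" using elim by (simp_all add: t_def add_pos_nonneg)
          then have "t * (1 + M\<^sup>2) < 2" by (simp only: pos_less_divide_eq)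
          then show ?thesis by (simp add: algebra_simps)
        qed
        ultimately have "M\<^sup>2 * t\<^sup>2 \<le> (Im u)\<^sup>2"
          using t by (simp add: power2_eq_square mult_left_mono mult.left_commute mult.commute)
        then have "(M * t)\<^sup>2 \<le> \<bar>Im u\<bar>\<^sup>2" by (simp add: power_mult_distrib)
        then have "M * t \<le> \<bar>Im u\<bar>" by (rule power2_le_imp_le) simp
        then have "M \<le> \<bar>- Im u / (1 - Re u)\<bar>" using t by (simp add: t_def field_simps)
        then show ?case using h(2) by (simp add: f_def)
      qed
      then have "(f \<longlongrightarrow> 0) (at 1 within sphere 0 1)" by (rule tendsto_eventually)
      moreover have "f 1 = 0" using s by (simp add: f_def)
      ultimately show ?thesis unfolding True continuous_within by simp
    qed
  qed
  obtain n E where E: "\<And>u. norm u = 1 \<Longrightarrow> norm (f u - poly E u / u ^ n) < e"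
    using trigonometric_approximation_on_circle[OF cont e] by blast
  show thesis
  proof (rule that)
    fix x :: real
    define u where "u = cayley 1 (complex_of_real x)"
    have u: "norm u = 1" by (simp add: u_def norm_cayley_of_real)
    have "1 - u \<noteq> 0" using norm_one_minus_cayley[of 1 "of_real x"] add_nonzero[of 1 "of_real x"]
      by (auto simp: u_def)
    then have "h x = (1 - u) ^ s * f u"
      using cayley_coordinate[of x] by (simp add: f_def u_def)
    moreover have "cayley_trig s n E x = (1 - u) ^ s * (poly E u / u ^ n)"
      by (simp add: cayley_trig_def u_def)
    ultimately have "h x - cayley_trig s n E x = (1 - u) ^ s * (f u - poly E u / u ^ n)"
      by (simp only: right_diff_distrib)
    then have "norm (h x - cayley_trig s n E x) = norm (1 - u) ^ s * norm (f u - poly E u / u ^ n)"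
      by (simp add: norm_mult norm_power)
    also have "\<dots> \<le> norm (1 - u) ^ s * e"
      using E[OF u] by (intro mult_left_mono) auto
    finally show "norm (h x - cayley_trig s n E x) \<le> e * norm (1 - cayley 1 (of_real x)) ^ s"
      by (simp add: u_def mult.commute)
  qed
qed

section \<open>Density in Lp\<close>

text \<open>Radial truncation of the values; together with the cut-off \<open>tent\<close> in the variable it makes bounded
  functions of compact support and, both being continuous, preserves continuity.\<close>
definition clip :: "real \<Rightarrow> complex \<Rightarrow> complex" where
  "clip M z = (M / max M (norm z)) *\<^sub>R z"

definition tent :: "real \<Rightarrow> real \<Rightarrow> real" where
  "tent M x = max 0 (min 1 (M + 1 - \<bar>x\<bar>))"

lemma norm_clip_le: "M > 0 \<Longrightarrow> norm (clip M z) \<le> M"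
  by (auto simp: clip_def max_def field_simps)

lemma clip_eq: "M > 0 \<Longrightarrow> norm z \<le> M \<Longrightarrow> clip M z = z"
  by (simp add: clip_def max_def)

lemma continuous_clip: "M > 0 \<Longrightarrow> continuous_on A (clip M)"
  unfolding clip_def by (intro continuous_intros) (auto simp: max_def)

lemma tent_bounds: "0 \<le> tent M x" "tent M x \<le> 1"
  by (auto simp: tent_def)

lemma norm_diff_clip_le:
  assumes "M > 0"
  shows "norm (z - tent M x *\<^sub>R clip M z) \<le> norm z"
proof -
  define l where "l = tent M x * (M / max M (norm z))"
  have "0 \<le> M / max M (norm z)" "M / max M (norm z) \<le> 1" using assms by (auto simp: max_def divide_le_eq)
  then have l: "0 \<le> l" "l \<le> 1" unfolding l_def using tent_bounds[of M x]
    by (auto intro!: mult_le_one mult_nonneg_nonneg simp del: times_divide_eq_right)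
  have "z - tent M x *\<^sub>R clip M z = (1 - l) *\<^sub>R z" by (simp add: clip_def l_def scaleR_diff_left)
  then show ?thesis using l by (simp add: mult_left_le_one_le)
qed

lemma continuous_tent: "continuous_on A (tent M)"
  unfolding tent_def by (intro continuous_intros)

lemma truncation_approximation:
  assumes p: "0 < p" and [measurable]: "f \<in> borel_measurable lebesgue" and fin: "mass p f < \<infinity>" and e: "e > 0"
  obtains M where "M > 0" "mass p (\<lambda>x. f x - tent M x *\<^sub>R clip M (f x)) < e"
proof -
  have meas: "(\<lambda>x. tent M x *\<^sub>R clip M (f x)) \<in> borel_measurable lebesgue" if "M > 0" for M
  proof -
    have "clip M \<in> borel_measurable borel" "tent M \<in> borel_measurable borel"
      using that by (auto intro!: borel_measurable_continuous_onI continuous_clip continuous_tent)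
    then have "(\<lambda>x. clip M (f x)) \<in> borel_measurable lebesgue" "tent M \<in> borel_measurable lebesgue"
      by (auto intro: measurable_compose[OF assms(2)] measurable_completion)
    then show ?thesis by measurable
  qed
  let ?u = "\<lambda>j x. ennreal (norm (f x - tent (Suc j) x *\<^sub>R clip (Suc j) (f x)) powr p)"
  have "(\<lambda>j. \<integral>\<^sup>+ x. ?u j x \<partial>lebesgue) \<longlonglongrightarrow> (\<integral>\<^sup>+ x. 0 \<partial>(lebesgue :: real measure))"
  proof (rule nn_integral_dominated_convergence)
    show "?u j \<in> borel_measurable lebesgue" for j
      using meas[of "Suc j"] by measurable
    show "(\<lambda>x. ennreal (norm (f x) powr p)) \<in> borel_measurable lebesgue" by measurable
    show "(\<integral>\<^sup>+ x. ennreal (norm (f x) powr p) \<partial>lebesgue) < \<infinity>" using fin by (simp add: mass_def)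
    show "AE x in lebesgue. ?u j x \<le> ennreal (norm (f x) powr p)" for j
      using p norm_diff_clip_le by (intro AE_I2 ennreal_leI powr_mono2) auto
    show "AE x in lebesgue. (\<lambda>j. ?u j x) \<longlonglongrightarrow> 0"
    proof (rule AE_I2)
      fix x
      obtain N :: nat where N: "\<bar>x\<bar> + norm (f x) \<le> real N" using real_arch_simple by blast
      have "?u j x = 0" if "j \<ge> N" for j
      proof -
        have "real N \<le> real j" using that by simp
        then have "\<bar>x\<bar> \<le> real j" "norm (f x) \<le> real (Suc j)"
          using N norm_ge_zero[of "f x"] abs_ge_zero[of x] by linarith+
        then have "norm (f x) \<le> real (Suc j)" "tent (Suc j) x = 1"
          by (auto simp: tent_def)
        then show ?thesis by (simp add: clip_eq)
      qed
      then show "(\<lambda>j. ?u j x) \<longlonglongrightarrow> 0"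
        by (intro tendsto_eventually) (auto simp: eventually_sequentially)
    qed
  qed simp
  then have "(\<lambda>j. mass p (\<lambda>x. f x - tent (Suc j) x *\<^sub>R clip (Suc j) (f x))) \<longlonglongrightarrow> 0"
    by (simp add: mass_def)
  then have "\<forall>\<^sub>F j in sequentially. mass p (\<lambda>x. f x - tent (Suc j) x *\<^sub>R clip (Suc j) (f x)) < e"
    using e by (rule order_tendstoD)
  then obtain j where "mass p (\<lambda>x. f x - tent (Suc j) x *\<^sub>R clip (Suc j) (f x)) < e"
    by (auto simp: eventually_sequentially)
  then show thesis by (intro that[of "Suc j"]) auto
qed

text \<open>A Lebesgue measurable function is an almost everywhere limit of continuous functions;
  truncating those as well provides a dominating function.\<close>
lemma continuous_approximation_of_truncation:
  assumes p: "0 < p" and f: "f \<in> borel_measurable lebesgue" and M: "M > 0" and e: "e > 0"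
  obtains h where "continuous_on UNIV h" "\<And>x. \<bar>x\<bar> \<ge> M + 1 \<Longrightarrow> h x = 0"
    "mass p (\<lambda>x. tent M x *\<^sub>R clip M (f x) - h x) < e"
proof -
  have "f measurable_on UNIV"
    using f by (subst measurable_on_iff_borel_measurable) auto
  then obtain Z g where Z: "negligible Z" "\<And>n. continuous_on UNIV (g n)"
    "\<And>x. x \<notin> Z \<Longrightarrow> (\<lambda>n. g n x) \<longlonglongrightarrow> f x"
    unfolding measurable_on_def by auto
  define h where "h n x = tent M x *\<^sub>R clip M (g n x)" for n x
  have h: "continuous_on UNIV (h n)" for n
    unfolding h_def by (intro continuous_intros continuous_tent continuous_on_compose2[OF continuous_clip[OF M] Z(2)]) auto
  have hm [measurable]: "h n \<in> borel_measurable lebesgue" for n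
    by (intro measurable_completion) (simp add: borel_measurable_continuous_onI h)
  have "clip M \<in> borel_measurable borel" "tent M \<in> borel_measurable borel"
    using M by (auto intro!: borel_measurable_continuous_onI continuous_clip continuous_tent)
  then have [measurable]: "(\<lambda>x. clip M (f x)) \<in> borel_measurable lebesgue" "tent M \<in> borel_measurable lebesgue"
    by (auto intro: measurable_compose[OF f] measurable_completion)
  let ?u = "\<lambda>j x. ennreal (norm (tent M x *\<^sub>R clip M (f x) - h j x) powr p)"
  let ?w = "\<lambda>x. ennreal ((2 * M) powr p) * indicator {- (M + 1)..M + 1} x"
  have "(\<lambda>j. \<integral>\<^sup>+ x. ?u j x \<partial>lebesgue) \<longlonglongrightarrow> (\<integral>\<^sup>+ x. 0 \<partial>(lebesgue :: real measure))"
  proof (rule nn_integral_dominated_convergence[where w = ?w])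
    show "?u j \<in> borel_measurable lebesgue" for j by measurable
    show "?w \<in> borel_measurable lebesgue" by (intro measurable_completion) measurable
    have "(\<integral>\<^sup>+ x. ?w x \<partial>lborel) = ennreal ((2 * M) powr p) * ennreal (2 * M + 2)"
      using M by (subst nn_integral_cmult_indicator) (auto simp: algebra_simps)
    then show "(\<integral>\<^sup>+ x. ?w x \<partial>lebesgue) < \<infinity>" by (simp add: nn_integral_completion ennreal_mult_less_top)
    show "AE x in lebesgue. ?u j x \<le> ?w x" for j
    proof (rule AE_I2)
      fix x
      have "norm (tent M x *\<^sub>R clip M (f x) - h j x) = tent M x * norm (clip M (f x) - clip M (g j x))"
        using tent_bounds[of M x] by (simp add: h_def flip: scaleR_diff_right)
      also have "\<dots> \<le> tent M x * (2 * M)"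
        using norm_triangle_ineq4[of "clip M (f x)" "clip M (g j x)"]
          norm_clip_le[OF M, of "f x"] norm_clip_le[OF M, of "g j x"] tent_bounds[of M x]
        by (intro mult_left_mono) auto
      finally have le: "norm (tent M x *\<^sub>R clip M (f x) - h j x) \<le> tent M x * (2 * M)" .
      show "?u j x \<le> ?w x"
      proof (cases "x \<in> {- (M + 1)..M + 1}")
        case True
        have "tent M x * (2 * M) \<le> 1 * (2 * M)"
          using tent_bounds[of M x] M by (intro mult_right_mono) auto
        with le True p show ?thesis by (auto intro!: ennreal_leI powr_mono2)
      next
        case False
        then have "tent M x = 0" by (auto simp: tent_def)
        with le False show ?thesis by simp
      qed
    qed
    have "AE x in lebesgue. x \<notin> Z"
      using Z(1) by (intro AE_not_in) (simp add: negligible_iff_null_sets)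
    then show "AE x in lebesgue. (\<lambda>j. ?u j x) \<longlonglongrightarrow> 0"
    proof eventually_elim
      case (elim x)
      have "(\<lambda>j. clip M (g j x)) \<longlonglongrightarrow> clip M (f x)"
        using continuous_clip[OF M, of UNIV] Z(3)[OF elim]
        by (intro isCont_tendsto_compose[where g = "clip M"]) (auto simp: continuous_on_eq_continuous_at)
      then have "(\<lambda>j. tent M x *\<^sub>R clip M (f x) - h j x) \<longlonglongrightarrow>
          tent M x *\<^sub>R clip M (f x) - tent M x *\<^sub>R clip M (f x)"
        unfolding h_def by (intro tendsto_intros)
      then have "(\<lambda>j. tent M x *\<^sub>R clip M (f x) - h j x) \<longlonglongrightarrow> 0" by simp
      then have "(\<lambda>j. norm (tent M x *\<^sub>R clip M (f x) - h j x)) \<longlonglongrightarrow> 0" by (rule tendsto_norm_zero)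
      then have "(\<lambda>j. norm (tent M x *\<^sub>R clip M (f x) - h j x) powr p) \<longlonglongrightarrow> 0 powr p"
        using p by (intro tendsto_powr2) auto
      from tendsto_ennrealI[OF this] show ?case using p by simp
    qed
  qed simp
  then have "(\<lambda>j. mass p (\<lambda>x. tent M x *\<^sub>R clip M (f x) - h j x)) \<longlonglongrightarrow> 0"
    by (simp add: mass_def)
  then have "\<forall>\<^sub>F j in sequentially. mass p (\<lambda>x. tent M x *\<^sub>R clip M (f x) - h j x) < e"
    using e by (rule order_tendstoD)
  then obtain j where j: "mass p (\<lambda>x. tent M x *\<^sub>R clip M (f x) - h j x) < e"
    by (auto simp: eventually_sequentially)
  show thesis
  proof (rule that[OF h _ j])
    show "h j x = 0" if "\<bar>x\<bar> \<ge> M + 1" for x using that by (auto simp: h_def tent_def)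
  qed
qed

lemma cayley_trig_dense:
  assumes p: "0 < p" "p \<le> 1" and f: "f \<in> borel_measurable lebesgue" "mass p f < \<infinity>"
    and e: "e > 0" and s: "real s * p \<ge> 2"
  obtains n E where "mass p (\<lambda>x. f x - cayley_trig s n E x) \<le> ennreal e"
proof -
  have e3: "0 < ennreal (e / 3)" using e by simp
  obtain M where M: "M > 0" "mass p (\<lambda>x. f x - tent M x *\<^sub>R clip M (f x)) < ennreal (e / 3)"
    using truncation_approximation[OF p(1) f e3] by blast
  obtain h where h: "continuous_on UNIV h" "\<And>x. \<bar>x\<bar> \<ge> M + 1 \<Longrightarrow> h x = 0"
    "mass p (\<lambda>x. tent M x *\<^sub>R clip M (f x) - h x) < ennreal (e / 3)"
    using continuous_approximation_of_truncation[OF p(1) f(1) M(1) e3] by blast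
  let ?w = "\<lambda>x. ennreal ((norm (1 - cayley 1 (of_real x)) ^ s) powr p)"
  obtain J where J: "J \<ge> 0" "(\<integral>\<^sup>+ x. ?w x \<partial>lborel) = ennreal J"
    using nn_integral_one_minus_cayley_finite[OF s] by (auto simp: less_top_ennreal)
  define \<eta> where "\<eta> = (e / 3 / (J + 1)) powr (1 / p)"
  have \<eta>: "\<eta> > 0" "\<eta> powr p = e / 3 / (J + 1)"
    using e J(1) p by (auto simp: \<eta>_def powr_powr)
  have "s > 0" using s by (intro Nat.gr0I) auto
  then obtain n E where E: "\<And>x. norm (h x - cayley_trig s n E x) \<le> \<eta> * norm (1 - cayley 1 (of_real x)) ^ s"
    using cayley_trig_approximation[of h "M + 1" \<eta> s] h(1,2) \<eta>(1) M(1) by auto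
  have "mass p (\<lambda>x. h x - cayley_trig s n E x) \<le> (\<integral>\<^sup>+ x. ennreal (\<eta> powr p) * ?w x \<partial>lborel)"
    unfolding mass_lborel
  proof (rule nn_integral_mono)
    fix x
    have "norm (h x - cayley_trig s n E x) powr p \<le> (\<eta> * norm (1 - cayley 1 (of_real x)) ^ s) powr p"
      using E[of x] p by (intro powr_mono2) auto
    also have "\<dots> = \<eta> powr p * (norm (1 - cayley 1 (of_real x)) ^ s) powr p"
      using \<eta> by (intro powr_mult)
    finally show "ennreal (norm (h x - cayley_trig s n E x) powr p) \<le> ennreal (\<eta> powr p) * ?w x"
      by (simp add: ennreal_leI flip: ennreal_mult)
  qed
  also have "\<dots> = ennreal (\<eta> powr p) * ennreal J"
    unfolding J(2)[symmetric] by (rule nn_integral_cmult) measurable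
  also have "\<dots> = ennreal (e / 3 * (J / (J + 1)))"
    using J(1) e unfolding \<eta>(2) by (simp flip: ennreal_mult)
  also have "\<dots> \<le> ennreal (e / 3)"
    using J(1) e by (intro ennreal_leI) (simp add: field_simps)
  finally have third: "mass p (\<lambda>x. h x - cayley_trig s n E x) \<le> ennreal (e / 3)" .
  define a where "a = (\<lambda>x. f x - tent M x *\<^sub>R clip M (f x))"
  define b where "b = (\<lambda>x. tent M x *\<^sub>R clip M (f x) - h x)"
  define d where "d = (\<lambda>x. h x - cayley_trig s n E x)"
  have "clip M \<in> borel_measurable borel" "tent M \<in> borel_measurable borel" "h \<in> borel_measurable borel"
    using M h(1) by (auto intro!: borel_measurable_continuous_onI continuous_clip continuous_tent)
  then have [measurable]: "(\<lambda>x. clip M (f x)) \<in> borel_measurable lebesgue" "tent M \<in> borel_measurable lebesgue"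
      "h \<in> borel_measurable lebesgue"
    by (auto intro: measurable_compose[OF f(1)] measurable_completion)
  have [measurable]: "cayley_trig s n E \<in> borel_measurable lebesgue"
    by (intro measurable_completion) measurable
  note f(1)[measurable]
  have [measurable]: "a \<in> borel_measurable lebesgue" "b \<in> borel_measurable lebesgue" "d \<in> borel_measurable lebesgue"
    unfolding a_def b_def d_def by measurable
  have "mass p (\<lambda>x. f x - cayley_trig s n E x) = mass p (\<lambda>x. a x + (b x + d x))"
    by (simp add: a_def b_def d_def)
  also have "\<dots> \<le> mass p a + mass p (\<lambda>x. b x + d x)"
    using p by (intro mass_add_le) measurable
  also have "\<dots> \<le> mass p a + (mass p b + mass p d)"
    using p by (intro add_left_mono mass_add_le) measurable
  also have "\<dots> \<le> ennreal (e / 3) + (ennreal (e / 3) + ennreal (e / 3))"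
    using M(2) h(3) third unfolding a_def b_def d_def by (intro add_mono) auto
  also have "\<dots> = ennreal e" using e by (simp flip: ennreal_plus)
  finally show thesis by (rule that)
qed

section \<open>Splitting one function\<close>

text \<open>One function on the line dominating \<open>P\<close> in the Stolz cones of every aperture. The dependence on
  the aperture is confined to the constant \<open>K\<close>, so that a single \<open>\<Psi>\<close>, selected once, serves all
  nontangential limits.\<close>
definition cone_dominated ::
    "real \<Rightarrow> (real \<Rightarrow> real) \<Rightarrow> (complex \<Rightarrow> complex) \<Rightarrow> (real \<Rightarrow> real) \<Rightarrow> bool" where
  "cone_dominated k K P \<Psi> \<longleftrightarrow> P holomorphic_on half_plane k \<and>
     (AE x in lborel. isCont P (of_real x) \<and> norm (P (of_real x)) \<le> \<Psi> x \<and>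
        (\<forall>\<alpha>>0. \<forall>z\<in>stolz_cone k \<alpha> x. norm (P z) \<le> K \<alpha> * \<Psi> x))"

text \<open>Expansion in the Cayley coordinate of the lower half-plane reverses the polynomial. Positive
  exponents are arranged because the cone estimate bounds \<open>\<bar>a\<bar> ^ (N - n)\<close> by \<open>1 - \<bar>a\<bar> ^ N\<close>, for
  which \<open>N - n < N\<close> is necessary.\<close>
lemma cayley_trig_forms:
  "\<exists>E1 n1 E2 n2. n1 \<ge> 1 \<and> n2 \<ge> 1 \<and>
    (\<forall>x. cayley_trig s n E x
      = (1 - cayley 1 (of_real x)) ^ s * poly E1 (cayley 1 (of_real x)) / cayley 1 (of_real x) ^ n1) \<and>
    (\<forall>x. cayley_trig s n E x
      = (1 - cayley (-1) (of_real x)) ^ s * poly E2 (cayley (-1) (of_real x)) / cayley (-1) (of_real x) ^ n2)"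
proof (intro exI conjI allI)
  define E2 where "E2 = smult ((-1) ^ s) (reflect_poly E * monom 1 (n + 1))"
  fix x :: real
  define u where "u = cayley 1 (complex_of_real x)"
  define v where "v = cayley (-1) (complex_of_real x)"
  have u: "u \<noteq> 0" using norm_cayley_of_real[of 1 x] by (auto simp: u_def)
  have v: "v = inverse u" by (simp add: u_def v_def cayley_uminus)
  have v0: "v \<noteq> 0" using u by (simp add: v)
  have uv: "u = inverse v" by (simp add: v)
  show "cayley_trig s n E x = (1 - cayley 1 (of_real x)) ^ s * poly (pCons 0 E) (cayley 1 (of_real x)) / cayley 1 (of_real x) ^ (n + 1)"
    using u by (simp add: cayley_trig_def flip: u_def)
  have "1 - inverse v = - (1 - v) * inverse v" using v0 by (simp add: field_simps)
  then have 1: "(1 - inverse v) ^ s = (-1) ^ s * (1 - v) ^ s * inverse v ^ s"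
    by (metis mult_minus1 power_mult_distrib)
  have 2: "poly E (inverse v) = poly (reflect_poly E) v * inverse v ^ degree E"
    using v0 by (simp add: poly_reflect_poly_nz field_simps)
  have "cayley_trig s n E x = (-1) ^ s * (1 - v) ^ s * inverse v ^ s
      * (poly (reflect_poly E) v * inverse v ^ degree E) / inverse v ^ n"
    unfolding cayley_trig_def u_def[symmetric] uv 1 2 ..
  also have "\<dots> = (1 - v) ^ s * poly E2 v / v ^ (degree E + s + 1)"
    using v0 by (simp add: E2_def poly_monom power_add power_inverse field_simps)
  finally show "cayley_trig s n E x = (1 - cayley (-1) (of_real x)) ^ s * poly E2 (cayley (-1) (of_real x))
      / cayley (-1) (of_real x) ^ (degree E + s + 1)"
    by (simp add: v_def)
qed auto

definition majorant :: "real \<Rightarrow> nat \<Rightarrow> real \<Rightarrow> (real \<Rightarrow> complex) \<Rightarrow> nat \<Rightarrow> complex \<Rightarrow> real \<Rightarrow> real" where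
  "majorant k s \<epsilon> R N c x =
     (norm (R x) + \<epsilon> * norm (1 - cayley k (of_real x)) ^ (s - 2)) / norm (1 - c * cayley k (of_real x) ^ N)"

text \<open>For fixed \<open>\<epsilon>\<close> the threshold for \<open>N\<close> does not depend on \<open>c\<close>, which leaves \<open>c\<close> free to be chosen
  by averaging afterwards.\<close>
lemma hardy_part_cone_dominated:
  assumes k: "\<bar>k\<bar> = 1" and s: "s \<ge> 2" and n: "n \<ge> 1" and \<epsilon>: "\<epsilon> > 0"
    and R: "\<And>x. R x = (1 - cayley k (of_real x)) ^ s * poly E (cayley k (of_real x)) / cayley k (of_real x) ^ n"
  shows "\<forall>\<^sub>F N in sequentially. \<forall>c. norm c = 1 \<longrightarrow> (\<exists>P. rational_function P \<and>
      cone_dominated k (\<lambda>\<alpha>. 2 * (2 + \<alpha>) ^ (s + 4)) P (majorant k s \<epsilon> R N c) \<and>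
      (AE x in lborel. c * cayley k (of_real x) ^ N \<noteq> 1 \<and> P (of_real x) = hardy_part k s E n N c (of_real x)))"
proof -
  obtain L where L: "L > 0" "\<And>a. norm a \<le> 1 \<Longrightarrow> norm (poly E a) \<le> L"
    "\<And>a b. norm a \<le> 1 \<Longrightarrow> norm b \<le> 1 \<Longrightarrow> norm (poly E a - poly E b) \<le> L * norm (a - b)"
    using poly_bounded_Lipschitz_unit_disc by blast
  obtain N0 :: nat where N0: "8 * L / \<epsilon> \<le> real N0" using real_arch_simple by blast
  show ?thesis
    unfolding eventually_sequentially
  proof (intro exI[of _ "max N0 (2 * n)"] allI impI)
    fix N and c :: complex assume N: "max N0 (2 * n) \<le> N" and c: "norm c = 1"
    have Nn: "N \<ge> 2 * n" "n \<le> N" "N \<ge> 1" using N n by auto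
    have "real N0 \<le> real N" using N by simp
    then have "8 * L / \<epsilon> \<le> real N" using N0 by linarith
    then have small: "8 * L / real N \<le> \<epsilon>" using \<epsilon> Nn by (simp add: field_simps)
    define \<Psi> where "\<Psi> = majorant k s \<epsilon> R N c"
    obtain P where P: "rational_function P"
      "finite {z. z + of_real k * \<i> = 0 \<or> c * cayley k z ^ N = 1}"
      "\<And>z. z + of_real k * \<i> \<noteq> 0 \<Longrightarrow> c * cayley k z ^ N \<noteq> 1 \<Longrightarrow>
        P z = hardy_part k s E n N c z \<and> P field_differentiable at z"
      using hardy_part_rational[OF k Nn(2,3)] by blast
    have up: "z + of_real k * \<i> \<noteq> 0 \<and> c * cayley k z ^ N \<noteq> 1" if "k * Im z > 0" for z
    proof
      show "z + of_real k * \<i> \<noteq> 0" using add_nonzero[OF k] that by simp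
      have "norm (c * cayley k z ^ N) < 1"
        using norm_cayley_less[OF k that] Nn c by (simp add: norm_mult norm_power power_less_one_iff)
      then show "c * cayley k z ^ N \<noteq> 1" by auto
    qed
    have AE: "AE x in lborel. c * cayley k (of_real x) ^ N \<noteq> 1"
    proof -
      have "finite (complex_of_real -` {z. z + of_real k * \<i> = 0 \<or> c * cayley k z ^ N = 1})"
        using P(2) by (rule finite_vimageI) (simp add: inj_of_real)
      then have "finite {x. c * cayley k (of_real x) ^ N = 1}"
        by (rule rev_finite_subset) auto
      then have "{x. c * cayley k (of_real x) ^ N = 1} \<in> null_sets lborel"
        by (rule finite_imp_null_set_lborel)
      then show ?thesis by (rule AE_I') auto
    qed
    have real_nz: "complex_of_real x + of_real k * \<i> \<noteq> 0" for x using add_nonzero[OF k, of "of_real x"] by simp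
    have nu: "norm (cayley k (of_real x)) = 1" for x by (rule norm_cayley_of_real[OF k])
    have nR: "norm ((1 - cayley k (of_real x)) ^ s * poly E (cayley k (of_real x))) = norm (R x)" for x
      unfolding R by (simp add: norm_mult norm_divide norm_power nu)
    have dom: "cone_dominated k (\<lambda>\<alpha>. 2 * (2 + \<alpha>) ^ (s + 4)) P \<Psi>"
      unfolding cone_dominated_def
    proof (intro conjI)
      show "P holomorphic_on half_plane k"
        unfolding holomorphic_on_def half_plane_def
        using P(3) up by (auto intro: field_differentiable_at_within)
      show "AE x in lborel. isCont P (of_real x) \<and> norm (P (of_real x)) \<le> \<Psi> x \<and>
        (\<forall>\<alpha>>0. \<forall>z\<in>stolz_cone k \<alpha> x. norm (P z) \<le> 2 * (2 + \<alpha>) ^ (s + 4) * \<Psi> x)"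
        using AE
      proof eventually_elim
        case (elim x)
        have Px: "P (of_real x) = hardy_part k s E n N c (of_real x)" "P field_differentiable at (of_real x)"
          using P(3)[OF real_nz elim] by auto
        have "norm (P (of_real x)) = norm (R x) / norm (1 - c * cayley k (of_real x) ^ N)"
          unfolding Px(1) hardy_part_def
          by (simp add: norm_mult norm_divide norm_power nu c flip: nR)
        also have "\<dots> \<le> \<Psi> x"
          unfolding \<Psi>_def majorant_def using \<epsilon> by (intro divide_right_mono) auto
        finally have 1: "norm (P (of_real x)) \<le> \<Psi> x" .
        have 2: "norm (P z) \<le> 2 * (2 + \<alpha>) ^ (s + 4) * \<Psi> x" if \<alpha>: "\<alpha> > 0" and z: "z \<in> stolz_cone k \<alpha> x" for \<alpha> z
        proof -
          have "k * Im z > 0" using z by (simp add: stolz_cone_def half_plane_def)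
          then have "P z = hardy_part k s E n N c z" using P(3) up by blast
          also have "norm \<dots> \<le> 2 * (2 + \<alpha>) ^ (s + 4) *
            ((norm (R x) + 8 * L / N * norm (1 - cayley k (of_real x)) ^ (s - 2)) / norm (1 - c * cayley k (of_real x) ^ N))"
            using hardy_part_cone_bound[OF k s L(2,3) Nn(1) n c \<alpha> z refl elim] unfolding nR .
          also have "\<dots> \<le> 2 * (2 + \<alpha>) ^ (s + 4) * \<Psi> x"
            unfolding \<Psi>_def majorant_def using small \<alpha>
            by (intro mult_left_mono divide_right_mono add_left_mono mult_right_mono) auto
          finally show ?thesis .
        qed
        show ?case using 1 2 Px(2) field_differentiable_imp_continuous_at by blast
      qed
    qed
    have "AE x in lborel. c * cayley k (of_real x) ^ N \<noteq> 1 \<and> P (of_real x) = hardy_part k s E n N c (of_real x)"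
      using AE by eventually_elim (use P(3) real_nz in blast)
    with P(1) dom show "\<exists>P. rational_function P \<and>
      cone_dominated k (\<lambda>\<alpha>. 2 * (2 + \<alpha>) ^ (s + 4)) P (majorant k s \<epsilon> R N c) \<and>
      (AE x in lborel. c * cayley k (of_real x) ^ N \<noteq> 1 \<and> P (of_real x) = hardy_part k s E n N c (of_real x))"
      unfolding \<Psi>_def by blast
  qed
qed

text \<open>The two holomorphic parts have the same majorant, since on the line the second one has
  conjugate denominator; one rotation therefore serves both.\<close>
lemma cayley_trig_splitting:
  fixes s :: nat
  assumes p: "0 < p" "p < 1" and s: "real (s - 2) * p \<ge> 2"
    and F: "mass p (cayley_trig s n E) \<le> ennreal F" and \<delta>: "\<delta> > 0" and F0: "F \<ge> 0"
  obtains P Q \<Psi> where "rational_function P" "rational_function Q"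
    "cone_dominated 1 (\<lambda>\<alpha>. 2 * (2 + \<alpha>) ^ (s + 4)) P \<Psi>"
    "cone_dominated (-1) (\<lambda>\<alpha>. 2 * (2 + \<alpha>) ^ (s + 4)) Q \<Psi>"
    "\<Psi> \<in> borel_measurable borel" "\<And>x. 0 \<le> \<Psi> x"
    "AE x in lborel. P (of_real x) + Q (of_real x) = cayley_trig s n E x"
    "(\<integral>\<^sup>+ x. ennreal (\<Psi> x powr p) \<partial>lborel) \<le> ennreal (4 / (1 - p) * (F + \<delta>))"
proof -
  define R where "R = cayley_trig s n E"
  have s2: "s \<ge> 2" using s p by (cases "s \<ge> 2") auto
  obtain E1 n1 E2 n2 where n: "n1 \<ge> 1" "n2 \<ge> 1"
    and R1: "\<And>x. R x = (1 - cayley 1 (of_real x)) ^ s * poly E1 (cayley 1 (of_real x)) / cayley 1 (of_real x) ^ n1"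
    and R2: "\<And>x. R x = (1 - cayley (-1) (of_real x)) ^ s * poly E2 (cayley (-1) (of_real x)) / cayley (-1) (of_real x) ^ n2"
    unfolding R_def using cayley_trig_forms[of s n E] by blast
  let ?d = "\<lambda>x. norm (1 - cayley 1 (of_real x))"
  let ?w = "\<lambda>x. ennreal ((?d x ^ (s - 2)) powr p)"
  obtain J where J: "J \<ge> 0" "(\<integral>\<^sup>+ x. ?w x \<partial>lborel) = ennreal J"
    using nn_integral_one_minus_cayley_finite[OF s] by (auto simp: less_top_ennreal)
  \<comment> \<open>Chosen so that the error term of the majorant contributes less than \<open>\<delta>\<close>.\<close>
  define \<epsilon> where "\<epsilon> = (\<delta> / (J + 1)) powr (1 / p)"
  have \<epsilon>: "\<epsilon> > 0" "\<epsilon> powr p = \<delta> / (J + 1)"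
    using \<delta> J(1) p by (auto simp: \<epsilon>_def powr_powr)
  have "\<forall>\<^sub>F N in sequentially. N \<ge> n1 \<and> N \<ge> n2"
    by (intro eventually_conj eventually_ge_at_top)
  with hardy_part_cone_dominated[OF _ s2 n(1) \<epsilon>(1) R1] hardy_part_cone_dominated[OF _ s2 n(2) \<epsilon>(1) R2]
  have "\<forall>\<^sub>F N in sequentially. (N \<ge> n1 \<and> N \<ge> n2) \<and>
     (\<forall>c. norm c = 1 \<longrightarrow> (\<exists>P. rational_function P \<and>
      cone_dominated 1 (\<lambda>\<alpha>. 2 * (2 + \<alpha>) ^ (s + 4)) P (majorant 1 s \<epsilon> R N c) \<and>
      (AE x in lborel. c * cayley 1 (of_real x) ^ N \<noteq> 1 \<and> P (of_real x) = hardy_part 1 s E1 n1 N c (of_real x)))) \<and>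
     (\<forall>c. norm c = 1 \<longrightarrow> (\<exists>P. rational_function P \<and>
      cone_dominated (-1) (\<lambda>\<alpha>. 2 * (2 + \<alpha>) ^ (s + 4)) P (majorant (-1) s \<epsilon> R N c) \<and>
      (AE x in lborel. c * cayley (-1) (of_real x) ^ N \<noteq> 1 \<and> P (of_real x) = hardy_part (-1) s E2 n2 N c (of_real x))))"
    by (intro eventually_conj) auto
  then obtain N where N: "N \<ge> n1" "N \<ge> n2"
    and PN: "\<And>c. norm c = 1 \<Longrightarrow> \<exists>P. rational_function P \<and>
      cone_dominated 1 (\<lambda>\<alpha>. 2 * (2 + \<alpha>) ^ (s + 4)) P (majorant 1 s \<epsilon> R N c) \<and>
      (AE x in lborel. c * cayley 1 (of_real x) ^ N \<noteq> 1 \<and> P (of_real x) = hardy_part 1 s E1 n1 N c (of_real x))"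
    and QN: "\<And>c. norm c = 1 \<Longrightarrow> \<exists>P. rational_function P \<and>
      cone_dominated (-1) (\<lambda>\<alpha>. 2 * (2 + \<alpha>) ^ (s + 4)) P (majorant (-1) s \<epsilon> R N c) \<and>
      (AE x in lborel. c * cayley (-1) (of_real x) ^ N \<noteq> 1 \<and> P (of_real x) = hardy_part (-1) s E2 n2 N c (of_real x))"
    unfolding eventually_sequentially by blast
  define a where "a x = norm (R x) + \<epsilon> * ?d x ^ (s - 2)" for x
  have [measurable]: "R \<in> borel_measurable borel" unfolding R_def by measurable
  have am [measurable]: "a \<in> borel_measurable borel" unfolding a_def by measurable
  have a0: "0 \<le> a x" for x unfolding a_def using \<epsilon> by simp
  have mass_a: "(\<integral>\<^sup>+ x. ennreal (a x powr p) \<partial>lborel) \<le> ennreal (F + \<delta> * (J / (J + 1)))"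
  proof -
    have "(\<integral>\<^sup>+ x. ennreal (a x powr p) \<partial>lborel) \<le> (\<integral>\<^sup>+ x. ennreal (norm (R x) powr p) + ennreal (\<epsilon> powr p) * ?w x \<partial>lborel)"
    proof (rule nn_integral_mono)
      fix x
      have "a x powr p \<le> norm (R x) powr p + (\<epsilon> * ?d x ^ (s - 2)) powr p"
        unfolding a_def using \<epsilon> p by (intro powr_add_le) auto
      also have "(\<epsilon> * ?d x ^ (s - 2)) powr p = \<epsilon> powr p * (?d x ^ (s - 2)) powr p"
        by (intro powr_mult)
      finally show "ennreal (a x powr p) \<le> ennreal (norm (R x) powr p) + ennreal (\<epsilon> powr p) * ?w x"
        by (simp add: ennreal_leI flip: ennreal_mult ennreal_plus)
    qed
    also have "\<dots> = mass p R + ennreal (\<epsilon> powr p) * ennreal J"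
      unfolding J(2)[symmetric] mass_lborel by (subst nn_integral_add) (auto simp: nn_integral_cmult)
    also have "\<dots> \<le> ennreal F + ennreal (\<epsilon> powr p) * ennreal J"
      using F by (intro add_right_mono) (simp add: R_def)
    also have "\<dots> = ennreal (F + \<delta> * (J / (J + 1)))"
      unfolding \<epsilon>(2) using J(1) \<delta> F0 by (simp flip: ennreal_mult ennreal_plus)
    finally show ?thesis .
  qed
  have strict: "ennreal (4 / (1 - p)) * (\<integral>\<^sup>+ x. ennreal (a x powr p) \<partial>lborel) < ennreal (4 / (1 - p) * (F + \<delta>))"
  proof -
    have "ennreal (4 / (1 - p)) * (\<integral>\<^sup>+ x. ennreal (a x powr p) \<partial>lborel)
        \<le> ennreal (4 / (1 - p)) * ennreal (F + \<delta> * (J / (J + 1)))"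
      by (intro mult_left_mono mass_a) auto
    also have "\<dots> = ennreal (4 / (1 - p) * (F + \<delta> * (J / (J + 1))))"
      using p by (intro ennreal_mult[symmetric]) (use F0 \<delta> J(1) in auto)
    also have "\<dots> < ennreal (4 / (1 - p) * (F + \<delta>))"
    proof (rule ennreal_lessI)
      have "\<delta> * (J / (J + 1)) < \<delta> * 1" using J(1) \<delta> by (intro mult_strict_left_mono) auto
      then show "4 / (1 - p) * (F + \<delta> * (J / (J + 1))) < 4 / (1 - p) * (F + \<delta>)"
        using p by (intro mult_strict_left_mono) auto
      show "0 < 4 / (1 - p) * (F + \<delta>)" using p F0 \<delta> by (intro mult_pos_pos) auto
    qed
    finally show ?thesis .
  qed
  have vm: "(\<lambda>x. cayley 1 (complex_of_real x) ^ N) \<in> borel_measurable borel" by measurable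
  have v1: "norm (cayley 1 (complex_of_real x) ^ N) = 1" for x
    by (simp add: norm_power norm_cayley_of_real)
  obtain c where c: "norm c = 1" "(\<integral>\<^sup>+ x. ennreal ((a x / norm (1 - c * cayley 1 (of_real x) ^ N)) powr p) \<partial>lborel)
      \<le> ennreal (4 / (1 - p) * (F + \<delta>))"
    using exists_good_rotation[OF p am vm a0 v1 strict] by blast
  define \<Psi> where "\<Psi> = majorant 1 s \<epsilon> R N c"
  have \<Psi>: "\<Psi> x = a x / norm (1 - c * cayley 1 (of_real x) ^ N)" for x
    by (simp add: \<Psi>_def majorant_def a_def)
  have cnj: "cayley (-1) (of_real x) = cnj (cayley 1 (of_real x))" for x
    by (simp add: cayley_def)
  have \<Psi>2: "majorant (-1) s \<epsilon> R N (cnj c) = \<Psi>"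
  proof
    fix x
    have "1 - cnj c * cayley (-1) (of_real x) ^ N = cnj (1 - c * cayley 1 (of_real x) ^ N)"
      "1 - cayley (-1) (of_real x) = cnj (1 - cayley 1 (of_real x))" by (simp_all add: cnj)
    then show "majorant (-1) s \<epsilon> R N (cnj c) x = \<Psi> x"
      by (simp only: \<Psi>_def majorant_def complex_mod_cnj)
  qed
  obtain P where P: "rational_function P" "cone_dominated 1 (\<lambda>\<alpha>. 2 * (2 + \<alpha>) ^ (s + 4)) P \<Psi>"
    "AE x in lborel. c * cayley 1 (of_real x) ^ N \<noteq> 1 \<and> P (of_real x) = hardy_part 1 s E1 n1 N c (of_real x)"
    using PN[OF c(1)] unfolding \<Psi>_def by blast
  obtain Q where Q: "rational_function Q" "cone_dominated (-1) (\<lambda>\<alpha>. 2 * (2 + \<alpha>) ^ (s + 4)) Q \<Psi>"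
    "AE x in lborel. cnj c * cayley (-1) (of_real x) ^ N \<noteq> 1 \<and> Q (of_real x) = hardy_part (-1) s E2 n2 N (cnj c) (of_real x)"
    using QN[of "cnj c"] c(1) unfolding \<Psi>2 complex_mod_cnj by blast
  show thesis
  proof (rule that[OF P(1) Q(1) P(2) Q(2)])
    show "\<Psi> \<in> borel_measurable borel" unfolding \<Psi>[abs_def] by measurable
    show "0 \<le> \<Psi> x" for x unfolding \<Psi> using a0 by simp
    show "AE x in lborel. P (of_real x) + Q (of_real x) = cayley_trig s n E x"
      using P(3) Q(3)
    proof eventually_elim
      case (elim x)
      then show ?case
        using hardy_parts_add[OF c(1) N(1,2) _ R1 R2] by (simp add: R_def)
    qed
    show "(\<integral>\<^sup>+ x. ennreal (\<Psi> x powr p) \<partial>lborel) \<le> ennreal (4 / (1 - p) * (F + \<delta>))"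
      using c(2) by (simp add: \<Psi>)
  qed
qed

lemma rational_function_0: "rational_function (\<lambda>z. 0)"
  unfolding rational_function_def by (intro exI[of _ 0] exI[of _ 1]) auto

text \<open>If \<open>F = 0\<close> the zero functions serve, which keeps the step available for every bound \<open>F\<close>;
  otherwise an approximant of mass at most \<open>3 / 2 * F\<close> is split with slack \<open>\<delta> = F\<close>.\<close>
lemma Lp_splitting_step:
  fixes s :: nat
  assumes p: "0 < p" "p < 1" and s: "real (s - 2) * p \<ge> 2"
    and f: "f \<in> borel_measurable lebesgue" "mass p f \<le> ennreal F" and F: "F \<ge> 0"
  obtains P Q \<Psi> where "rational_function P" "rational_function Q"
    "cone_dominated 1 (\<lambda>\<alpha>. 2 * (2 + \<alpha>) ^ (s + 4)) P \<Psi>"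
    "cone_dominated (-1) (\<lambda>\<alpha>. 2 * (2 + \<alpha>) ^ (s + 4)) Q \<Psi>"
    "\<Psi> \<in> borel_measurable borel" "\<And>x. 0 \<le> \<Psi> x"
    "mass p (\<lambda>x. f x - (P (of_real x) + Q (of_real x))) \<le> ennreal (F / 2)"
    "(\<integral>\<^sup>+ x. ennreal (\<Psi> x powr p) \<partial>lborel) \<le> ennreal (10 / (1 - p) * F)"
proof (cases "F = 0")
  case True
  show thesis
  proof (rule that[of "\<lambda>_. 0" "\<lambda>_. 0" "\<lambda>_. 0"])
    show "mass p (\<lambda>x. f x - (0 + 0)) \<le> ennreal (F / 2)" using f(2) True by simp
  qed (auto simp: rational_function_0 cone_dominated_def True)
next
  case False
  with F have F0: "F > 0" by simp
  have s': "real s * p \<ge> 2" using s p by (smt (verit) diff_le_self mult_right_mono of_nat_mono)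
  have fin: "mass p f < \<infinity>" using f(2) by (simp add: order.strict_trans1)
  obtain n E where E: "mass p (\<lambda>x. f x - cayley_trig s n E x) \<le> ennreal (F / 2)"
    using cayley_trig_dense[OF p(1) _ f(1) fin _ s', of "F / 2"] F0 p by auto
  note f(1)[measurable]
  have [measurable]: "cayley_trig s n E \<in> borel_measurable lebesgue"
    by (intro measurable_completion) measurable
  have "mass p (cayley_trig s n E) = mass p (\<lambda>x. f x + - (f x - cayley_trig s n E x))" by simp
  also have "\<dots> \<le> mass p f + mass p (\<lambda>x. - (f x - cayley_trig s n E x))"
    using p by (intro mass_add_le) auto
  also have "\<dots> \<le> ennreal F + ennreal (F / 2)"
    unfolding mass_minus using f(2) E by (intro add_mono)
  also have "\<dots> = ennreal (3 / 2 * F)" using F0 by (simp flip: ennreal_plus)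
  finally have R: "mass p (cayley_trig s n E) \<le> ennreal (3 / 2 * F)" .
  obtain P Q \<Psi> where PQ: "rational_function P" "rational_function Q"
    "cone_dominated 1 (\<lambda>\<alpha>. 2 * (2 + \<alpha>) ^ (s + 4)) P \<Psi>"
    "cone_dominated (-1) (\<lambda>\<alpha>. 2 * (2 + \<alpha>) ^ (s + 4)) Q \<Psi>"
    "\<Psi> \<in> borel_measurable borel" "\<And>x. 0 \<le> \<Psi> x"
    "AE x in lborel. P (of_real x) + Q (of_real x) = cayley_trig s n E x"
    "(\<integral>\<^sup>+ x. ennreal (\<Psi> x powr p) \<partial>lborel) \<le> ennreal (4 / (1 - p) * (3 / 2 * F + F))"
    using cayley_trig_splitting[OF p s R F0] F0 by auto
  show thesis
  proof (rule that[OF PQ(1-6)])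
    have "mass p (\<lambda>x. f x - (P (of_real x) + Q (of_real x))) = mass p (\<lambda>x. f x - cayley_trig s n E x)"
    proof (rule mass_cong_AE, rule AE_completion)
      show "AE x in lborel. f x - (P (of_real x) + Q (of_real x)) = f x - cayley_trig s n E x"
        using PQ(7) by eventually_elim simp
    qed
    with E show "mass p (\<lambda>x. f x - (P (of_real x) + Q (of_real x))) \<le> ennreal (F / 2)" by simp
    show "(\<integral>\<^sup>+ x. ennreal (\<Psi> x powr p) \<partial>lborel) \<le> ennreal (10 / (1 - p) * F)"
    proof -
      have "4 / q * (3 / 2 * F + F) = 10 / q * F" for q :: real
        by (cases "q = 0") (simp_all add: field_simps)
      with PQ(8) show ?thesis by (simp only:)
    qed
  qed
qed

section \<open>Series of cone-dominated functions\<close>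

lemma borel_measurable_rational_function:
  assumes "rational_function P"
  shows "(\<lambda>x. P (complex_of_real x)) \<in> borel_measurable borel"
proof -
  obtain a b :: "complex poly" where "P = (\<lambda>z. poly a z / poly b z)"
    using assms by (auto simp: rational_function_def)
  then show ?thesis by (simp add: borel_measurable_divide borel_measurable_poly)
qed

lemma borel_measurable_horizontal:
  assumes "F holomorphic_on half_plane k" "k * y > 0"
  shows "(\<lambda>x. F (Complex x y)) \<in> borel_measurable borel"
proof (rule borel_measurable_continuous_onI)
  show "continuous_on UNIV (\<lambda>x. F (Complex x y))"
    by (rule continuous_on_compose2[OF holomorphic_on_imp_continuous_on[OF assms(1)], of _ "\<lambda>x. Complex x y"])
      (auto simp: half_plane_def assms(2) Complex_eq intro!: continuous_intros)
qed

lemma cone_dominated_mass_le: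
  assumes p: "0 < p" and k: "\<bar>k\<bar> = 1" and dom: "cone_dominated k K P \<Psi>" and K: "K 1 \<ge> 0"
    and \<Psi>: "\<Psi> \<in> borel_measurable borel" "\<And>x. 0 \<le> \<Psi> x" and y: "k * y > 0"
  shows "mass p (\<lambda>x. P (Complex x y)) \<le> ennreal (K 1 powr p) * (\<integral>\<^sup>+ x. ennreal (\<Psi> x powr p) \<partial>lborel)"
proof -
  note \<Psi>(1)[measurable]
  have "mass p (\<lambda>x. P (Complex x y)) \<le> (\<integral>\<^sup>+ x. ennreal (K 1 powr p) * ennreal (\<Psi> x powr p) \<partial>lborel)"
    unfolding mass_lborel
  proof (rule nn_integral_mono_AE)
    have "AE x in lborel. \<forall>\<alpha>>0. \<forall>z\<in>stolz_cone k \<alpha> x. norm (P z) \<le> K \<alpha> * \<Psi> x"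
      using dom unfolding cone_dominated_def by (auto elim: eventually_mono)
    then show "AE x in lborel. ennreal (norm (P (Complex x y)) powr p) \<le> ennreal (K 1 powr p) * ennreal (\<Psi> x powr p)"
    proof eventually_elim
      case (elim x)
      have "y \<noteq> 0" using y by auto
      then have "Complex x y \<in> stolz_cone k 1 x" using y by (simp add: stolz_cone_def half_plane_def)
      then have "norm (P (Complex x y)) \<le> K 1 * \<Psi> x" using elim[rule_format, of 1] by simp
      then have "norm (P (Complex x y)) powr p \<le> (K 1 * \<Psi> x) powr p" using p by (intro powr_mono2) auto
      also have "\<dots> = K 1 powr p * \<Psi> x powr p" by (rule powr_mult)
      finally show ?case by (simp add: ennreal_leI flip: ennreal_mult)
    qed
  qed
  also have "\<dots> = ennreal (K 1 powr p) * (\<integral>\<^sup>+ x. ennreal (\<Psi> x powr p) \<partial>lborel)"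
    by (rule nn_integral_cmult) measurable
  finally show ?thesis .
qed

lemma cone_dominated_Hp:
  assumes p: "0 < p" and k: "\<bar>k\<bar> = 1" and dom: "cone_dominated k K P \<Psi>" and K: "K 1 \<ge> 0"
    and \<Psi>: "\<Psi> \<in> borel_measurable borel" "\<And>x. 0 \<le> \<Psi> x"
    and I: "(\<integral>\<^sup>+ x. ennreal (\<Psi> x powr p) \<partial>lborel) \<le> ennreal D" "D \<ge> 0"
  shows "P \<in> Hp p k" "epowr (Hp_norm p k P) p \<le> ennreal (K 1 powr p * D)"
proof -
  have "Hp_norm p k P \<le> epowr (ennreal (K 1 powr p * D)) (1 / p)"
  proof (rule Hp_norm_le[OF p])
    fix y assume "k * y > 0"
    then have "mass p (\<lambda>x. P (Complex x y)) \<le> ennreal (K 1 powr p) * (\<integral>\<^sup>+ x. ennreal (\<Psi> x powr p) \<partial>lborel)"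
      by (rule cone_dominated_mass_le[OF p k dom K \<Psi>])
    also have "\<dots> \<le> ennreal (K 1 powr p) * ennreal D" by (intro mult_left_mono I) auto
    also have "\<dots> = ennreal (K 1 powr p * D)" using I(2) by (simp add: ennreal_mult)
    finally show "mass p (\<lambda>x. P (Complex x y)) \<le> ennreal (K 1 powr p * D)" .
  qed
  note this
  moreover have "epowr (ennreal (K 1 powr p * D)) (1 / p) < top" by (simp add: epowr_less_top_iff)
  ultimately have "Hp_norm p k P < top" by (rule order.strict_trans1)
  then show "P \<in> Hp p k" using dom by (simp add: Hp_def cone_dominated_def)
  have "epowr (Hp_norm p k P) p \<le> epowr (epowr (ennreal (K 1 powr p * D)) (1 / p)) p"
    by (rule epowr_mono) fact+
  then show "epowr (Hp_norm p k P) p \<le> ennreal (K 1 powr p * D)" by (simp add: epowr_epowr_inverse[OF p])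
qed

text \<open>A point at height at least \<open>y\<close> lies in the unit Stolz cones of a whole interval of length \<open>y\<close>;
  averaging the cone bound over that interval gives a pointwise bound.\<close>
lemma cone_dominated_pointwise:
  assumes p: "0 < p" and k: "\<bar>k\<bar> = 1" and dom: "cone_dominated k K P \<Psi>" and K: "K 1 \<ge> 0"
    and \<Psi>: "\<Psi> \<in> borel_measurable borel" "\<And>x. 0 \<le> \<Psi> x"
    and I: "(\<integral>\<^sup>+ x. ennreal (\<Psi> x powr p) \<partial>lborel) \<le> ennreal D" "D \<ge> 0"
    and y: "0 < y" "y \<le> k * Im z"
  shows "norm (P z) \<le> (K 1 powr p * D / y) powr (1 / p)"
proof -
  note \<Psi>(1)[measurable]
  have absy: "\<bar>Im z\<bar> = k * Im z" using y k by (metis abs_mult abs_of_pos mult_1 order_less_le_trans)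
  have "ennreal (norm (P z) powr p * y) \<le> ennreal (norm (P z) powr p) * emeasure lborel {Re z..<Re z + y}"
    using y by (simp add: ennreal_mult)
  also have "\<dots> = (\<integral>\<^sup>+ x. ennreal (norm (P z) powr p) * indicator {Re z..<Re z + y} x \<partial>lborel)"
    by (rule nn_integral_cmult_indicator[symmetric]) simp
  also have "\<dots> \<le> (\<integral>\<^sup>+ x. ennreal (K 1 powr p) * ennreal (\<Psi> x powr p) \<partial>lborel)"
  proof (rule nn_integral_mono_AE)
    have "AE x in lborel. \<forall>\<alpha>>0. \<forall>z\<in>stolz_cone k \<alpha> x. norm (P z) \<le> K \<alpha> * \<Psi> x"
      using dom unfolding cone_dominated_def by (auto elim: eventually_mono)
    then show "AE x in lborel. ennreal (norm (P z) powr p) * indicator {Re z..<Re z + y} x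
        \<le> ennreal (K 1 powr p) * ennreal (\<Psi> x powr p)"
    proof eventually_elim
      case (elim x)
      show ?case
      proof (cases "x \<in> {Re z..<Re z + y}")
        case True
        then have "z \<in> stolz_cone k 1 x" using y by (auto simp: stolz_cone_def half_plane_def absy)
        then have "norm (P z) \<le> K 1 * \<Psi> x" using elim[rule_format, of 1] by simp
        then have "norm (P z) powr p \<le> (K 1 * \<Psi> x) powr p" using p by (intro powr_mono2) auto
        also have "\<dots> = K 1 powr p * \<Psi> x powr p" by (rule powr_mult)
        finally show ?thesis using True by (simp add: ennreal_leI flip: ennreal_mult)
      qed simp
    qed
  qed
  also have "\<dots> = ennreal (K 1 powr p) * (\<integral>\<^sup>+ x. ennreal (\<Psi> x powr p) \<partial>lborel)"
    by (rule nn_integral_cmult) measurable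
  also have "\<dots> \<le> ennreal (K 1 powr p) * ennreal D" by (intro mult_left_mono I) auto
  also have "\<dots> = ennreal (K 1 powr p * D)" using I(2) by (simp add: ennreal_mult)
  finally have "norm (P z) powr p * y \<le> K 1 powr p * D" using I(2) by (subst (asm) ennreal_le_iff) auto
  then have "norm (P z) powr p \<le> K 1 powr p * D / y" using y by (simp add: field_simps)
  then have "(norm (P z) powr p) powr (1 / p) \<le> (K 1 powr p * D / y) powr (1 / p)"
    using p by (intro powr_mono2) auto
  then show ?thesis using p by (simp add: powr_powr)
qed

lemma suminf_halves_ennreal:
  assumes "B \<ge> 0"
  shows "(\<Sum>j. ennreal (B * (1 / 2) ^ j)) = ennreal (2 * B)"
proof -
  have "(\<lambda>j. B * (1 / 2) ^ j) sums (B * (1 / (1 - 1 / 2)))"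
    by (intro sums_mult geometric_sums) simp
  then have "(\<lambda>j. B * (1 / 2) ^ j) sums (2 * B)" by (simp add: mult.commute)
  then show ?thesis using assms by (intro suminf_ennreal_eq) auto
qed

text \<open>Geometric decay of the integrals gives local uniform convergence through the pointwise bound,
  and almost everywhere summability of the majorants. At a point \<open>x\<close> where they are summable, the
  series is dominated in each cone with vertex \<open>x\<close>, so limit and sum may be interchanged.\<close>
lemma cone_dominated_series:
  fixes P :: "nat \<Rightarrow> complex \<Rightarrow> complex"
  assumes p: "0 < p" "p < 1" and k: "\<bar>k\<bar> = 1" and K: "\<forall>\<alpha>>0. K \<alpha> \<ge> 0"
    and rat: "\<And>j. rational_function (P j)"
    and dom: "\<And>j. cone_dominated k K (P j) (\<Psi> j)"
    and \<Psi>: "\<And>j. \<Psi> j \<in> borel_measurable borel" "\<And>j x. 0 \<le> \<Psi> j x"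
    and I: "\<And>j. (\<integral>\<^sup>+ x. ennreal (\<Psi> j x powr p) \<partial>lborel) \<le> ennreal (D * (1 / 2) ^ j)" and D: "D \<ge> 0"
  defines "g \<equiv> \<lambda>z. \<Sum>j. P j z" and "gb \<equiv> \<lambda>x. \<Sum>j. P j (complex_of_real x)"
  shows "\<And>z. z \<in> half_plane k \<Longrightarrow> (\<lambda>j. P j z) sums g z"
    and "g \<in> Hp p k" and "has_boundary_function k g gb"
    and "AE x in lebesgue. (\<lambda>j. P j (of_real x)) sums gb x"
    and "gb \<in> borel_measurable lebesgue"
    and "mass p gb \<le> ennreal (2 * D)"
proof -
  note [measurable] = \<Psi>(1) borel_measurable_rational_function[OF rat]
  have p1: "p \<le> 1" using p by simp
  have K1: "K 1 \<ge> 0" using K by simp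
  have Dj: "D * (1 / 2) ^ j \<ge> 0" for j :: nat using D by simp
  define M where "M y j = (K 1 powr p * (D * (1 / 2) ^ j) / y) powr (1 / p)" for y and j :: nat
  have bound: "norm (P j z) \<le> M y j" if "0 < y" "y \<le> k * Im z" for j y z
    unfolding M_def by (rule cone_dominated_pointwise[OF p(1) k dom K1 \<Psi> I Dj that])
  have M: "summable (M y)" if "y > 0" for y
  proof (rule summable_of_summable_powr[OF p(1) p1])
    have "(\<lambda>j. M y j powr p) = (\<lambda>j. (K 1 powr p * D / y) * (1 / 2) ^ j)"
      using p D that by (auto simp: M_def powr_powr)
    then show "summable (\<lambda>j. M y j powr p)" by (simp add: summable_mult summable_geometric)
  qed (simp add: M_def)
  show sums: "(\<lambda>j. P j z) sums g z" if "z \<in> half_plane k" for z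
  proof -
    have "k * Im z > 0" using that by (simp add: half_plane_def)
    then have "summable (\<lambda>j. P j z)"
      by (intro summable_comparison_test[OF _ M[of "k * Im z"]]) (auto intro: bound)
    then show ?thesis unfolding g_def by (rule summable_sums)
  qed
  have hol: "g holomorphic_on half_plane k"
  proof (rule holomorphic_uniform_sequence)
    show "open (half_plane k)" unfolding half_plane_def by (intro open_Collect_less continuous_intros)
    show "(\<lambda>z. \<Sum>j<n. P j z) holomorphic_on half_plane k" for n
      using dom by (intro holomorphic_intros) (simp add: cone_dominated_def)
    fix z assume "z \<in> half_plane k"
    then have Y: "k * Im z > 0" by (simp add: half_plane_def)
    define y where "y = k * Im z / 2"
    have low: "y \<le> k * Im w" if "w \<in> cball z y" for w
    proof -
      have "\<bar>k * Im z - k * Im w\<bar> = \<bar>Im (z - w)\<bar>" using k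
        by (simp add: abs_mult flip: right_diff_distrib)
      also have "\<dots> \<le> norm (z - w)" by (rule abs_Im_le_cmod)
      also have "\<dots> \<le> y" using that by (simp add: dist_norm)
      finally show ?thesis unfolding y_def by linarith
    qed
    have y: "y > 0" using Y by (simp add: y_def)
    show "\<exists>d>0. cball z d \<subseteq> half_plane k \<and> uniform_limit (cball z d) (\<lambda>n z. \<Sum>j<n. P j z) g sequentially"
    proof (intro exI[of _ y] conjI)
      show "cball z y \<subseteq> half_plane k" using low y by (force simp: half_plane_def)
      show "uniform_limit (cball z y) (\<lambda>n z. \<Sum>j<n. P j z) g sequentially"
        unfolding g_def by (rule Weierstrass_m_test[OF _ M[OF y]]) (use bound low y in blast)
    qed (rule y)
  qed
  have total: "(\<Sum>j. ennreal (B * (D * (1 / 2) ^ j))) = ennreal (2 * (B * D))" if "B \<ge> 0" for B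
  proof -
    have "B * D \<ge> 0" using that D by simp
    from suminf_halves_ennreal[OF this] show ?thesis by (simp only: mult.assoc)
  qed
  have "Hp_norm p k g \<le> epowr (ennreal (2 * (K 1 powr p * D))) (1 / p)"
  proof (rule Hp_norm_le[OF p(1)])
    fix y assume y: "k * y > 0"
    have [measurable]: "(\<lambda>x. P j (Complex x y)) \<in> borel_measurable borel" for j
      using dom y by (intro borel_measurable_horizontal[of _ k]) (auto simp: cone_dominated_def)
    have "mass p (\<lambda>x. g (Complex x y)) \<le> (\<integral>\<^sup>+ x. (\<Sum>j. ennreal (norm (P j (Complex x y)) powr p)) \<partial>lborel)"
      unfolding mass_lborel
      by (intro nn_integral_mono norm_sums_powr_le[OF p(1) p1] sums) (simp add: half_plane_def y)
    also have "\<dots> = (\<Sum>j. mass p (\<lambda>x. P j (Complex x y)))"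
      unfolding mass_lborel by (rule nn_integral_suminf) measurable
    also have "\<dots> \<le> (\<Sum>j. ennreal (K 1 powr p * (D * (1 / 2) ^ j)))"
    proof (rule suminf_le)
      show "mass p (\<lambda>x. P j (Complex x y)) \<le> ennreal (K 1 powr p * (D * (1 / 2) ^ j))" for j
      proof -
        have "mass p (\<lambda>x. P j (Complex x y)) \<le> ennreal (K 1 powr p) * (\<integral>\<^sup>+ x. ennreal (\<Psi> j x powr p) \<partial>lborel)"
          by (rule cone_dominated_mass_le[OF p(1) k dom K1 \<Psi> y])
        also have "\<dots> \<le> ennreal (K 1 powr p) * ennreal (D * (1 / 2) ^ j)" by (intro mult_left_mono I) auto
        finally show ?thesis using D by (simp add: ennreal_mult)
      qed
    qed auto
    also have "\<dots> = ennreal (2 * (K 1 powr p * D))" by (rule total) simp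
    finally show "mass p (\<lambda>x. g (Complex x y)) \<le> ennreal (2 * (K 1 powr p * D))" .
  qed
  moreover have "epowr (ennreal (2 * (K 1 powr p * D))) (1 / p) < top" by (simp add: epowr_less_top_iff)
  ultimately have "Hp_norm p k g < top" by (rule order.strict_trans1)
  with hol show "g \<in> Hp p k" by (simp add: Hp_def)
  have "AE x in lebesgue. summable (\<lambda>j. norm (complex_of_real (\<Psi> j x)))"
  proof (rule AE_summable_of_summable_mass[OF p(1) p1])
    show "(\<lambda>x. complex_of_real (\<Psi> j x)) \<in> borel_measurable lebesgue" for j
      by (intro measurable_completion) measurable
    have "(\<Sum>j. mass p (\<lambda>x. complex_of_real (\<Psi> j x))) \<le> (\<Sum>j. ennreal (1 * (D * (1 / 2) ^ j)))"
      using I \<Psi>(2) by (intro suminf_le) (auto simp: mass_lborel)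
    also have "\<dots> = ennreal (2 * (1 * D))" by (rule total) simp
    finally show "(\<Sum>j. mass p (\<lambda>x. complex_of_real (\<Psi> j x))) < \<infinity>" by (rule order.strict_trans1) simp
  qed
  then have AEsum: "AE x in lebesgue. summable (\<lambda>j. \<Psi> j x)" using \<Psi>(2) by simp
  have AEdom: "AE x in lebesgue. \<forall>j. isCont (P j) (of_real x) \<and> norm (P j (of_real x)) \<le> \<Psi> j x \<and>
        (\<forall>\<alpha>>0. \<forall>z\<in>stolz_cone k \<alpha> x. norm (P j z) \<le> K \<alpha> * \<Psi> j x)"
    unfolding AE_all_countable using dom by (auto simp: cone_dominated_def intro: AE_completion)
  show AEgb: "AE x in lebesgue. (\<lambda>j. P j (of_real x)) sums gb x"
    using AEsum AEdom
  proof eventually_elim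
    case (elim x)
    then have "summable (\<lambda>j. P j (of_real x))"
      by (intro summable_comparison_test[OF _ elim(1)]) auto
    then show ?case unfolding gb_def by (rule summable_sums)
  qed
  show "has_boundary_function k g gb"
    unfolding has_boundary_function_def has_nontangential_limit_def
    using AEsum AEdom
  proof eventually_elim
    case (elim x)
    show ?case
    proof (intro allI impI)
      fix \<alpha> :: real assume \<alpha>: "\<alpha> > 0"
      let ?F = "at (complex_of_real x) within stolz_cone k \<alpha> x"
      show "(g \<longlongrightarrow> gb x) ?F"
      proof (cases "?F = bot")
        case False
        have "\<forall>\<^sub>F (j, z) in sequentially \<times>\<^sub>F ?F. norm (P j z) \<le> K \<alpha> * \<Psi> j x"
          unfolding eventually_prod_filter
        proof (intro exI conjI)
          show "\<forall>\<^sub>F j in sequentially. True" by simp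
          show "\<forall>\<^sub>F z in ?F. z \<in> stolz_cone k \<alpha> x" by (simp add: eventually_at_filter)
        qed (use elim(2) \<alpha> in auto)
        moreover have "(P j \<longlongrightarrow> P j (of_real x)) ?F" for j
          using elim(2) by (auto simp: isCont_def intro: tendsto_within_subset)
        ultimately show ?thesis
          unfolding g_def gb_def
          using tannerys_theorem[of "\<lambda>j z. P j z" "\<lambda>j. P j (of_real x)" ?F "\<lambda>j. K \<alpha> * \<Psi> j x"]
            elim(1) False by (auto intro: summable_mult)
      qed simp
    qed
  qed
  show "gb \<in> borel_measurable lebesgue" unfolding gb_def by (intro measurable_completion) measurable
  have "mass p gb \<le> (\<integral>\<^sup>+ x. (\<Sum>j. ennreal (norm (P j (of_real x)) powr p)) \<partial>lebesgue)"
    unfolding mass_def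
  proof (rule nn_integral_mono_AE)
    show "AE x in lebesgue. ennreal (norm (gb x) powr p) \<le> (\<Sum>j. ennreal (norm (P j (of_real x)) powr p))"
      using AEgb by eventually_elim (rule norm_sums_powr_le[OF p(1) p1])
  qed
  also have "\<dots> \<le> (\<integral>\<^sup>+ x. (\<Sum>j. ennreal (\<Psi> j x powr p)) \<partial>lebesgue)"
  proof (rule nn_integral_mono_AE)
    show "AE x in lebesgue. (\<Sum>j. ennreal (norm (P j (of_real x)) powr p)) \<le> (\<Sum>j. ennreal (\<Psi> j x powr p))"
      using AEdom
    proof eventually_elim
      case (elim x)
      then show ?case using p by (intro suminf_le ennreal_leI powr_mono2) auto
    qed
  qed
  also have "\<dots> = (\<integral>\<^sup>+ x. (\<Sum>j. ennreal (\<Psi> j x powr p)) \<partial>lborel)" by (rule nn_integral_completion)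
  also have "\<dots> = (\<Sum>j. (\<integral>\<^sup>+ x. ennreal (\<Psi> j x powr p) \<partial>lborel))" by (rule nn_integral_suminf) measurable
  also have "\<dots> \<le> (\<Sum>j. ennreal (1 * (D * (1 / 2) ^ j)))" using I by (intro suminf_le) auto
  also have "\<dots> = ennreal (2 * (1 * D))" by (rule total) simp
  finally show "mass p gb \<le> ennreal (2 * D)" by simp
qed

text \<open>The boundary function is an almost everywhere limit along vertical sequences, so Fatou applies.\<close>
lemma Hp_boundary_subset_Lp:
  assumes p: "0 < p" and k: "\<bar>k\<bar> = 1"
  shows "Hp_boundary p k \<subseteq> Lp p"
proof
  fix u assume "u \<in> Hp_boundary p k"
  then obtain F where F: "F \<in> Hp p k" "has_boundary_function k F u" by (auto simp: Hp_boundary_def)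
  define y where "y n = k / real (Suc n)" for n
  have kk: "k * k = 1" using k by (metis abs_mult_self_eq mult_1)
  have y: "k * y n > 0" for n using kk by (simp add: y_def)
  have hol: "F holomorphic_on half_plane k" using F(1) by (simp add: Hp_def)
  have [measurable]: "(\<lambda>x. F (Complex x (y n))) \<in> borel_measurable lebesgue" for n
    by (intro measurable_completion) (use borel_measurable_horizontal[OF hol y] in simp)
  have lim: "AE x in lebesgue. (\<lambda>n. F (Complex x (y n))) \<longlonglongrightarrow> u x"
    using F(2) unfolding has_boundary_function_def
  proof eventually_elim
    case (elim x)
    then have "(F \<longlongrightarrow> u x) (at (complex_of_real x) within stolz_cone k 1 x)"
      by (simp add: has_nontangential_limit_def)
    moreover have "filterlim (\<lambda>n. Complex x (y n)) (at (complex_of_real x) within stolz_cone k 1 x) sequentially"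
      unfolding filterlim_at
    proof
      have "y n \<noteq> 0" for n using y[of n] by auto
      then show "\<forall>\<^sub>F n in sequentially. Complex x (y n) \<in> stolz_cone k 1 x \<and> Complex x (y n) \<noteq> complex_of_real x"
        using y by (auto simp: stolz_cone_def half_plane_def complex_eq_iff)
      have "y \<longlonglongrightarrow> 0" unfolding y_def using LIMSEQ_Suc[OF lim_const_over_n[of k]] by simp
      then have "(\<lambda>n. Complex x (y n)) \<longlonglongrightarrow> Complex x 0" by (intro tendsto_Complex tendsto_const)
      then show "(\<lambda>n. Complex x (y n)) \<longlonglongrightarrow> complex_of_real x" by (simp add: complex_of_real_def)
    qed
    ultimately show ?case by (rule filterlim_compose)
  qed
  have "(\<lambda>x. lim (\<lambda>n. F (Complex x (y n)))) \<in> borel_measurable lebesgue" by measurable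
  moreover have "AE x in lebesgue. lim (\<lambda>n. F (Complex x (y n))) = u x"
    using lim by eventually_elim (rule limI)
  ultimately have u: "u \<in> borel_measurable lebesgue" by (rule borel_measurable_AE)
  have "mass p u \<le> (\<integral>\<^sup>+ x. liminf (\<lambda>n. ennreal (norm (F (Complex x (y n))) powr p)) \<partial>lebesgue)"
    unfolding mass_def
  proof (rule nn_integral_mono_AE)
    show "AE x in lebesgue. ennreal (norm (u x) powr p) \<le> liminf (\<lambda>n. ennreal (norm (F (Complex x (y n))) powr p))"
      using lim
    proof eventually_elim
      case (elim x)
      then have "(\<lambda>n. norm (F (Complex x (y n))) powr p) \<longlonglongrightarrow> norm (u x) powr p"
        using p by (intro tendsto_powr2 tendsto_norm tendsto_const) auto
      then have "(\<lambda>n. ennreal (norm (F (Complex x (y n))) powr p)) \<longlonglongrightarrow> ennreal (norm (u x) powr p)"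
        by (rule tendsto_ennrealI)
      from lim_imp_Liminf[OF _ this] show ?case by simp
    qed
  qed
  also have "\<dots> \<le> liminf (\<lambda>n. mass p (\<lambda>x. F (Complex x (y n))))"
    unfolding mass_def by (rule nn_integral_liminf) measurable
  also have "\<dots> \<le> epowr (Hp_norm p k F) p"
  proof (rule Liminf_le)
    show "\<forall>\<^sub>F n in sequentially. mass p (\<lambda>x. F (Complex x (y n))) \<le> epowr (Hp_norm p k F) p"
      using mass_horizontal_le[OF p y] by simp
  qed simp
  also have "\<dots> < \<infinity>" using F(1) by (simp add: Hp_def epowr_less_top_iff)
  finally show "u \<in> Lp p" using u by (simp add: mem_Lp_iff)
qed

section \<open>Iteration and the decomposition\<close>

lemma Lp_iterated_splitting:
  fixes s :: nat
  assumes p: "0 < p" "p < 1" and s: "real (s - 2) * p \<ge> 2"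
    and f: "f \<in> borel_measurable lebesgue" "mass p f \<le> ennreal F" and F: "F \<ge> 0"
  obtains P Q :: "nat \<Rightarrow> complex \<Rightarrow> complex" and \<Psi> :: "nat \<Rightarrow> real \<Rightarrow> real" where
    "\<And>j. rational_function (P j)" "\<And>j. rational_function (Q j)"
    "\<And>j. cone_dominated 1 (\<lambda>\<alpha>. 2 * (2 + \<alpha>) ^ (s + 4)) (P j) (\<Psi> j)"
    "\<And>j. cone_dominated (-1) (\<lambda>\<alpha>. 2 * (2 + \<alpha>) ^ (s + 4)) (Q j) (\<Psi> j)"
    "\<And>j. \<Psi> j \<in> borel_measurable borel" "\<And>j x. 0 \<le> \<Psi> j x"
    "\<And>j. (\<integral>\<^sup>+ x. ennreal (\<Psi> j x powr p) \<partial>lborel) \<le> ennreal (10 / (1 - p) * F * (1 / 2) ^ j)"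
    "\<And>n. mass p (\<lambda>x. f x - (\<Sum>j<n. P j (of_real x) + Q j (of_real x))) \<le> ennreal (F * (1 / 2) ^ n)"
proof -
  \<comment> \<open>A state is a remainder \<open>\<phi>\<close> together with the parts split off from it and their majorant.\<close>
  define good where "good = (\<lambda>n (\<phi> :: real \<Rightarrow> complex, P, Q, \<Psi>).
    \<phi> \<in> borel_measurable lebesgue \<and> mass p \<phi> \<le> ennreal (F * (1 / 2) ^ n) \<and>
    rational_function P \<and> rational_function Q \<and>
    cone_dominated 1 (\<lambda>\<alpha>. 2 * (2 + \<alpha>) ^ (s + 4)) P \<Psi> \<and>
    cone_dominated (-1) (\<lambda>\<alpha>. 2 * (2 + \<alpha>) ^ (s + 4)) Q \<Psi> \<and>
    \<Psi> \<in> borel_measurable borel \<and> (\<forall>x. 0 \<le> \<Psi> x) \<and>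
    mass p (\<lambda>x. \<phi> x - (P (of_real x) + Q (of_real x))) \<le> ennreal (F * (1 / 2) ^ Suc n) \<and>
    (\<integral>\<^sup>+ x. ennreal (\<Psi> x powr p) \<partial>lborel) \<le> ennreal (10 / (1 - p) * F * (1 / 2) ^ n))"
  have step: "\<exists>P Q \<Psi>. good n (\<phi>, P, Q, \<Psi>)"
    if \<phi>: "\<phi> \<in> borel_measurable lebesgue" "mass p \<phi> \<le> ennreal (F * (1 / 2) ^ n)" for n \<phi>
  proof -
    have "F * (1 / 2) ^ n \<ge> 0" using F by simp
    from Lp_splitting_step[OF p s \<phi> this] obtain P Q \<Psi> where
      "rational_function P" "rational_function Q"
      "cone_dominated 1 (\<lambda>\<alpha>. 2 * (2 + \<alpha>) ^ (s + 4)) P \<Psi>"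
      "cone_dominated (-1) (\<lambda>\<alpha>. 2 * (2 + \<alpha>) ^ (s + 4)) Q \<Psi>"
      "\<Psi> \<in> borel_measurable borel" "\<And>x. 0 \<le> \<Psi> x"
      "mass p (\<lambda>x. \<phi> x - (P (of_real x) + Q (of_real x))) \<le> ennreal (F * (1 / 2) ^ n / 2)"
      "(\<integral>\<^sup>+ x. ennreal (\<Psi> x powr p) \<partial>lborel) \<le> ennreal (10 / (1 - p) * (F * (1 / 2) ^ n))"
      by blast
    then have "good n (\<phi>, P, Q, \<Psi>)" using \<phi> by (simp add: good_def mult.assoc)
    then show ?thesis by blast
  qed
  define next_step where "next_step =
    (\<lambda>(\<phi> :: real \<Rightarrow> complex, P, Q, \<Psi> :: real \<Rightarrow> real) (\<phi>', P' :: complex \<Rightarrow> complex, Q' :: complex \<Rightarrow> complex, \<Psi>' :: real \<Rightarrow> real).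
      \<phi>' = (\<lambda>x. \<phi> x - (P (complex_of_real x) + Q (complex_of_real x))))"
  have "\<exists>t. \<forall>n. (good n (t n) \<and> (n = 0 \<longrightarrow> fst (t n) = f)) \<and> next_step (t n) (t (Suc n))"
  proof (rule dependent_nat_choice)
    show "\<exists>t. good 0 t \<and> (0 = 0 \<longrightarrow> fst t = f)" using step[of f 0] f by auto
    fix t n assume t: "good n t \<and> (n = 0 \<longrightarrow> fst t = f)"
    obtain \<phi> P Q \<Psi> where t': "t = (\<phi>, P, Q, \<Psi>)" by (cases t)
    define \<phi>' where "\<phi>' = (\<lambda>x. \<phi> x - (P (complex_of_real x) + Q (complex_of_real x)))"
    have g: "\<phi> \<in> borel_measurable lebesgue" "rational_function P" "rational_function Q"
      "mass p \<phi>' \<le> ennreal (F * (1 / 2) ^ Suc n)"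
      using t unfolding t' good_def \<phi>'_def by auto
    have "(\<lambda>x. P (complex_of_real x)) \<in> borel_measurable lebesgue" "(\<lambda>x. Q (complex_of_real x)) \<in> borel_measurable lebesgue"
      using g(2,3) by (auto intro!: measurable_completion simp: borel_measurable_rational_function)
    then have "\<phi>' \<in> borel_measurable lebesgue"
      unfolding \<phi>'_def by (intro borel_measurable_diff borel_measurable_add g(1))
    from step[OF this g(4)] obtain P' Q' \<Psi>' where "good (Suc n) (\<phi>', P', Q', \<Psi>')" by blast
    then show "\<exists>t'. (good (Suc n) t' \<and> (Suc n = 0 \<longrightarrow> fst t' = f)) \<and>
      next_step t t'"
      by (intro exI[of _ "(\<phi>', P', Q', \<Psi>')"]) (simp add: t' \<phi>'_def next_step_def)
  qed
  then obtain t where t: "\<And>n. good n (t n)" "fst (t 0) = f"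
    "\<And>n. next_step (t n) (t (Suc n))"
    by blast
  define \<phi> where "\<phi> n = fst (t n)" for n
  define P where "P n = fst (snd (t n))" for n
  define Q where "Q n = fst (snd (snd (t n)))" for n
  define \<Psi> where "\<Psi> n = snd (snd (snd (t n)))" for n
  have tt: "t n = (\<phi> n, P n, Q n, \<Psi> n)" for n by (simp add: \<phi>_def P_def Q_def \<Psi>_def)
  have G: "good n (\<phi> n, P n, Q n, \<Psi> n)" for n using t(1)[of n] by (simp only: tt)
  have S: "\<phi> (Suc n) = (\<lambda>x. \<phi> n x - (P n (of_real x) + Q n (of_real x)))" for n
    using t(3)[of n] by (simp only: tt next_step_def split_conv)
  have \<phi>: "\<phi> n = (\<lambda>x. f x - (\<Sum>j<n. P j (of_real x) + Q j (of_real x)))" for n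
  proof (induction n)
    case 0
    show ?case using t(2) by (simp add: \<phi>_def)
  next
    case (Suc n)
    show ?case unfolding S Suc by (simp add: algebra_simps)
  qed
  show thesis
  proof (rule that[of P Q \<Psi>])
    show "mass p (\<lambda>x. f x - (\<Sum>j<n. P j (of_real x) + Q j (of_real x))) \<le> ennreal (F * (1 / 2) ^ n)" for n
      using G[of n] unfolding \<phi>[symmetric] by (simp add: good_def)
  qed (use G in \<open>auto simp: good_def\<close>)
qed

lemma Lp_decomposition:
  fixes s :: nat
  assumes p: "0 < p" "p < 1" and s: "real (s - 2) * p \<ge> 2" and f: "f \<in> Lp p"
  defines "K \<equiv> (2 * 3 ^ (s + 4)) powr p"
  defines "A \<equiv> 4 * (K + 1) * (10 / (1 - p))"
  shows "\<exists>P Q :: nat \<Rightarrow> complex \<Rightarrow> complex.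
              (\<forall>k. rational_function (P k) \<and> P k \<in> Hp p 1) \<and>
              (\<forall>k. rational_function (Q k) \<and> Q k \<in> Hp p (-1)) \<and>
              (\<Sum>k. epowr (Hp_norm p 1 (P k)) p + epowr (Hp_norm p (-1) (Q k)) p)
                \<le> ennreal A * epowr (Lp_norm p f) p \<and>
              (\<lambda>n. Lp_norm p (\<lambda>x. f x - (\<Sum>k<n. P k (complex_of_real x) + Q k (complex_of_real x))))
                \<longlonglongrightarrow> 0 \<and>
              (\<exists>g h :: complex \<Rightarrow> complex. \<exists>gb hb :: real \<Rightarrow> complex.
                 (\<forall>z \<in> half_plane 1. (\<lambda>k. P k z) sums g z) \<and>
                 (\<forall>z \<in> half_plane (-1). (\<lambda>k. Q k z) sums h z) \<and>
                 g \<in> Hp p 1 \<and> h \<in> Hp p (-1) \<and>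
                 has_boundary_function 1 g gb \<and> has_boundary_function (-1) h hb \<and>
                 (AE x in lebesgue. f x = gb x + hb x) \<and>
                 epowr (Lp_norm p f) p \<le> epowr (Lp_norm p gb) p + epowr (Lp_norm p hb) p \<and>
                 epowr (Lp_norm p gb) p + epowr (Lp_norm p hb) p
                   \<le> ennreal A * epowr (Lp_norm p f) p)"
proof -
  have fm[measurable]: "f \<in> borel_measurable lebesgue" and fin: "mass p f < \<infinity>" using f by (auto simp: mem_Lp_iff)
  obtain F where F: "F \<ge> 0" "mass p f = ennreal F" using fin by (auto simp: less_top_ennreal)
  have p1: "p \<le> 1" using p by simp
  define D where "D = 10 / (1 - p) * F"
  have D: "D \<ge> 0" using p F by (simp add: D_def)
  have K0: "K \<ge> 0" by (simp add: K_def)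
  let ?K = "\<lambda>\<alpha>::real. 2 * (2 + \<alpha>) ^ (s + 4)"
  have K1: "?K 1 powr p = K" by (simp add: K_def)
  have Kpos: "\<forall>\<alpha>>0. ?K \<alpha> \<ge> 0" by simp
  obtain P Q \<Psi> where
    rat: "\<And>j. rational_function (P j)" "\<And>j. rational_function (Q j)"
    and dom: "\<And>j. cone_dominated 1 ?K (P j) (\<Psi> j)" "\<And>j. cone_dominated (-1) ?K (Q j) (\<Psi> j)"
    and \<Psi>: "\<And>j. \<Psi> j \<in> borel_measurable borel" "\<And>j x. 0 \<le> \<Psi> j x"
    and I: "\<And>j. (\<integral>\<^sup>+ x. ennreal (\<Psi> j x powr p) \<partial>lborel) \<le> ennreal (D * (1 / 2) ^ j)"
    and rest: "\<And>n. mass p (\<lambda>x. f x - (\<Sum>j<n. P j (of_real x) + Q j (of_real x))) \<le> ennreal (F * (1 / 2) ^ n)"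
    using Lp_iterated_splitting[OF p s fm _ F(1)] F(2) unfolding D_def by auto
  have Dj: "D * (1 / 2) ^ j \<ge> 0" for j :: nat using D by simp
  have k: "\<bar>1::real\<bar> = 1" "\<bar>-1::real\<bar> = 1" by simp_all
  have K1': "?K 1 \<ge> 0" by simp
  note HP = cone_dominated_Hp[OF p(1) k(1) dom(1) K1' \<Psi> I Dj, unfolded K1]
  note HQ = cone_dominated_Hp[OF p(1) k(2) dom(2) K1' \<Psi> I Dj, unfolded K1]
  define g where "g z = (\<Sum>j. P j z)" for z
  define gb where "gb x = (\<Sum>j. P j (complex_of_real x))" for x
  define h where "h z = (\<Sum>j. Q j z)" for z
  define hb where "hb x = (\<Sum>j. Q j (complex_of_real x))" for x
  note G = cone_dominated_series[OF p k(1) Kpos rat(1) dom(1) \<Psi> I D, folded gb_def, folded g_def]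
  note H = cone_dominated_series[OF p k(2) Kpos rat(2) dom(2) \<Psi> I D, folded hb_def, folded h_def]
  have AF: "ennreal B \<le> ennreal A * epowr (Lp_norm p f) p" if "B \<le> 4 * (K + 1) * D" for B
  proof -
    have "A \<ge> 0" using p K0 by (simp add: A_def)
    then have "ennreal A * epowr (Lp_norm p f) p = ennreal (A * F)"
      using F by (simp add: epowr_Lp_norm[OF p(1)] ennreal_mult)
    also have "A * F = 4 * (K + 1) * D" by (simp add: A_def D_def)
    finally show ?thesis using that by (simp add: ennreal_leI)
  qed
  have KD: "0 \<le> K * D" using K0 D by simp
  have norms: "(\<Sum>k. epowr (Hp_norm p 1 (P k)) p + epowr (Hp_norm p (-1) (Q k)) p) \<le> ennreal A * epowr (Lp_norm p f) p"
  proof -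
    have "(\<Sum>k. epowr (Hp_norm p 1 (P k)) p + epowr (Hp_norm p (-1) (Q k)) p)
        \<le> (\<Sum>k. ennreal (2 * (K * D) * (1 / 2) ^ k))"
    proof (rule suminf_le)
      fix j
      have "epowr (Hp_norm p 1 (P j)) p + epowr (Hp_norm p (-1) (Q j)) p
          \<le> ennreal (K * (D * (1 / 2) ^ j)) + ennreal (K * (D * (1 / 2) ^ j))"
        by (intro add_mono HP(2) HQ(2))
      also have "\<dots> = ennreal (2 * (K * D) * (1 / 2) ^ j)"
        using K0 D by (simp flip: ennreal_plus add: mult.assoc)
      finally show "epowr (Hp_norm p 1 (P j)) p + epowr (Hp_norm p (-1) (Q j)) p
          \<le> ennreal (2 * (K * D) * (1 / 2) ^ j)" .
    qed auto
    also have "\<dots> = ennreal (2 * (2 * (K * D)))" using KD by (intro suminf_halves_ennreal) simp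
    also have "\<dots> \<le> ennreal A * epowr (Lp_norm p f) p" using D by (intro AF) (simp add: algebra_simps)
    finally show ?thesis .
  qed
  have conv: "(\<lambda>n. Lp_norm p (\<lambda>x. f x - (\<Sum>k<n. P k (complex_of_real x) + Q k (complex_of_real x)))) \<longlonglongrightarrow> 0"
  proof (rule tendsto_sandwich[OF _ _ tendsto_const])
    have "Lp_norm p (\<lambda>x. f x - (\<Sum>k<n. P k (complex_of_real x) + Q k (complex_of_real x)))
        \<le> ennreal ((F * (1 / 2) ^ n) powr (1 / p))" for n
    proof -
      have "Lp_norm p (\<lambda>x. f x - (\<Sum>k<n. P k (complex_of_real x) + Q k (complex_of_real x)))
          \<le> epowr (ennreal (F * (1 / 2) ^ n)) (1 / p)"
        unfolding Lp_norm_def using rest[of n] p by (intro epowr_mono) (auto simp: mass_def)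
      then show ?thesis using F(1) by (simp add: epowr_def)
    qed
    then show "\<forall>\<^sub>F n in sequentially. Lp_norm p (\<lambda>x. f x - (\<Sum>k<n. P k (complex_of_real x) + Q k (complex_of_real x)))
        \<le> ennreal ((F * (1 / 2) ^ n) powr (1 / p))" by simp
    have "(\<lambda>n. F * (1 / 2) ^ n) \<longlonglongrightarrow> F * 0"
      by (intro tendsto_mult tendsto_const LIMSEQ_power_zero) simp
    then have "(\<lambda>n. (F * (1 / 2) ^ n) powr (1 / p)) \<longlonglongrightarrow> (F * 0) powr (1 / p)"
      using p F(1) by (intro tendsto_powr2) auto
    from tendsto_ennrealI[OF this] show "(\<lambda>n. ennreal ((F * (1 / 2) ^ n) powr (1 / p))) \<longlonglongrightarrow> 0" by simp
  qed simp
  have "AE x in lebesgue. summable (\<lambda>n. norm (f x - (\<Sum>j<n. P j (of_real x) + Q j (of_real x))))"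
  proof (rule AE_summable_of_summable_mass[OF p(1) p1])
    have [measurable]: "(\<lambda>x. P j (complex_of_real x)) \<in> borel_measurable lebesgue"
        "(\<lambda>x. Q j (complex_of_real x)) \<in> borel_measurable lebesgue" for j
      using rat by (auto intro!: measurable_completion simp: borel_measurable_rational_function)
    show "(\<lambda>x. f x - (\<Sum>j<n. P j (of_real x) + Q j (of_real x))) \<in> borel_measurable lebesgue" for n
      by measurable
    have "(\<Sum>n. mass p (\<lambda>x. f x - (\<Sum>j<n. P j (of_real x) + Q j (of_real x)))) \<le> (\<Sum>n. ennreal (F * (1 / 2) ^ n))"
      using rest by (intro suminf_le) auto
    also have "\<dots> = ennreal (2 * F)" by (rule suminf_halves_ennreal[OF F(1)])
    finally show "(\<Sum>n. mass p (\<lambda>x. f x - (\<Sum>j<n. P j (of_real x) + Q j (of_real x)))) < \<infinity>"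
      by (rule order.strict_trans1) simp
  qed
  then have AEf: "AE x in lebesgue. f x = gb x + hb x"
    using G(4) H(4)
  proof eventually_elim
    case (elim x)
    have "(\<lambda>n. \<Sum>j<n. P j (of_real x) + Q j (of_real x)) \<longlonglongrightarrow> gb x + hb x"
      using sums_add[OF elim(2,3)] by (simp add: sums_def)
    then have "(\<lambda>n. f x - (\<Sum>j<n. P j (of_real x) + Q j (of_real x))) \<longlonglongrightarrow> f x - (gb x + hb x)"
      by (intro tendsto_diff tendsto_const)
    moreover have "(\<lambda>n. f x - (\<Sum>j<n. P j (of_real x) + Q j (of_real x))) \<longlonglongrightarrow> 0"
      using summable_LIMSEQ_zero[OF elim(1)] by (rule tendsto_norm_zero_cancel)
    ultimately show ?case using LIMSEQ_unique by fastforce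
  qed
  have low: "epowr (Lp_norm p f) p \<le> epowr (Lp_norm p gb) p + epowr (Lp_norm p hb) p"
    unfolding epowr_Lp_norm[OF p(1)] mass_cong_AE[OF AEf] by (rule mass_add_le[OF p(1) p1 G(5) H(5)])
  have up: "epowr (Lp_norm p gb) p + epowr (Lp_norm p hb) p \<le> ennreal A * epowr (Lp_norm p f) p"
  proof -
    have "epowr (Lp_norm p gb) p + epowr (Lp_norm p hb) p \<le> ennreal (2 * D) + ennreal (2 * D)"
      unfolding epowr_Lp_norm[OF p(1)] by (intro add_mono G(6) H(6))
    also have "\<dots> = ennreal (4 * D)" using D by (simp flip: ennreal_plus)
    also have "\<dots> \<le> ennreal A * epowr (Lp_norm p f) p"
      using KD by (intro AF) (simp add: algebra_simps)
    finally show ?thesis .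
  qed
  show ?thesis
    by (intro exI[of _ P] exI[of _ Q] exI[of _ g] exI[of _ h] exI[of _ gb] exI[of _ hb] conjI allI ballI
      rat HP(1) HQ(1) norms conv G(1-3) H(1-3) AEf low up)
qed

theorem theorem2:
  fixes p :: real
  assumes "0 < p" and "p < 1"
  shows "(\<exists>A::real. A > 0 \<and>
           (\<forall>f \<in> Lp p. \<exists>P Q :: nat \<Rightarrow> complex \<Rightarrow> complex.
              (\<forall>k. rational_function (P k) \<and> P k \<in> Hp p 1) \<and>
              (\<forall>k. rational_function (Q k) \<and> Q k \<in> Hp p (-1)) \<and>
              (\<Sum>k. epowr (Hp_norm p 1 (P k)) p + epowr (Hp_norm p (-1) (Q k)) p)
                \<le> ennreal A * epowr (Lp_norm p f) p \<and>
              (\<lambda>n. Lp_norm p (\<lambda>x. f x - (\<Sum>k<n. P k (complex_of_real x) + Q k (complex_of_real x))))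
                \<longlonglongrightarrow> 0 \<and>
              (\<exists>g h :: complex \<Rightarrow> complex. \<exists>gb hb :: real \<Rightarrow> complex.
                 (\<forall>z \<in> half_plane 1. (\<lambda>k. P k z) sums g z) \<and>
                 (\<forall>z \<in> half_plane (-1). (\<lambda>k. Q k z) sums h z) \<and>
                 g \<in> Hp p 1 \<and> h \<in> Hp p (-1) \<and>
                 has_boundary_function 1 g gb \<and> has_boundary_function (-1) h hb \<and>
                 (AE x in lebesgue. f x = gb x + hb x) \<and>
                 epowr (Lp_norm p f) p \<le> epowr (Lp_norm p gb) p + epowr (Lp_norm p hb) p \<and>
                 epowr (Lp_norm p gb) p + epowr (Lp_norm p hb) p
                   \<le> ennreal A * epowr (Lp_norm p f) p)))
         \<and> Lp p = {f. \<exists>u \<in> Hp_boundary p 1. \<exists>v \<in> Hp_boundary p (-1).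
                        AE x in lebesgue. f x = u x + v x}"
proof -
  \<comment> \<open>The decay exponent: two factors \<open>1 - u\<close> are spent in the cone estimate, and the remaining ones
    must be integrable to the power \<open>p\<close>.\<close>
  obtain m :: nat where m: "2 / p \<le> real m" using real_arch_simple by blast
  define s where "s = m + 2"
  have s: "real (s - 2) * p \<ge> 2" using m assms by (simp add: s_def field_simps)
  define A where "A = 4 * ((2 * 3 ^ (s + 4)) powr p + 1) * (10 / (1 - p))"
  have A: "A > 0" unfolding A_def using assms by (intro mult_pos_pos add_nonneg_pos divide_pos_pos) auto
  note dec = Lp_decomposition[OF assms s, folded A_def]
  have "Lp p = {f. \<exists>u \<in> Hp_boundary p 1. \<exists>v \<in> Hp_boundary p (-1). AE x in lebesgue. f x = u x + v x}"
  proof (intro equalityI subsetI)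
    fix f assume "f \<in> Lp p"
    from dec[OF this] obtain g h gb hb where "g \<in> Hp p 1" "h \<in> Hp p (-1)"
      "has_boundary_function 1 g gb" "has_boundary_function (-1) h hb"
      "AE x in lebesgue. f x = gb x + hb x"
      by blast
    then show "f \<in> {f. \<exists>u \<in> Hp_boundary p 1. \<exists>v \<in> Hp_boundary p (-1). AE x in lebesgue. f x = u x + v x}"
      unfolding Hp_boundary_def by blast
  next
    fix f assume "f \<in> {f. \<exists>u \<in> Hp_boundary p 1. \<exists>v \<in> Hp_boundary p (-1). AE x in lebesgue. f x = u x + v x}"
    then obtain u v where uv: "u \<in> Lp p" "v \<in> Lp p" "AE x in lebesgue. f x = u x + v x"
      using Hp_boundary_subset_Lp[OF assms(1), of 1] Hp_boundary_subset_Lp[OF assms(1), of "-1"] by auto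
    have uvm: "u \<in> borel_measurable lebesgue" "v \<in> borel_measurable lebesgue" using uv by (auto simp: mem_Lp_iff)
    then have "(\<lambda>x. u x + v x) \<in> borel_measurable lebesgue" by (rule borel_measurable_add)
    moreover have "AE x in lebesgue. u x + v x = f x" using uv(3) by eventually_elim simp
    ultimately have fm: "f \<in> borel_measurable lebesgue" by (rule borel_measurable_AE)
    have "mass p f \<le> mass p u + mass p v"
      unfolding mass_cong_AE[OF uv(3)] using assms uvm by (intro mass_add_le) auto
    also have "\<dots> < \<infinity>" using uv by (auto simp: mem_Lp_iff)
    finally show "f \<in> Lp p" using fm by (simp add: mem_Lp_iff)
  qed
  with A dec show ?thesis by blast
qed

end
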